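(* Let $H_x$ ($x\in X$) be the family of discrete Schrödinger operators over the mixing Markov shift on $X=\{0,a,b,c\}^{\mathbb{Z}}$ described in the context, with potential determined by $\upsilon(0)=0$, $\upsilon(a)=\upsilon(c)=-e$, $\upsilon(b)=-e^{-1}$, and let $N(E)$ be its integrated density of states. Then for any $\beta>2$, the function $E\mapsto N(E)$ is not $(1,\beta)$-log-Hölder continuous at $E=0$.
   Context: Markov shift. Let $\Sigma=\{0,a,b,c\}$, $X=\Sigma^{\mathbb{Z}}$, and let $T:X\to X$, $T\{x_n\}_{n\in\mathbb{Z}}=\{x_{n+1}\}_{n\in\mathbb{Z}}$, be the two-sided shift. Consider the Markov chain on $\Sigma$ with transitions $0\to 0$ and $0\to a$ with probability $\frac12$ each, $a\to b$ with probability $1$, $b\to c$ with probability $1$, $c\to 0$ and $c\to a$ with probability $\frac12$ each. With the states ordered as $0,a,b,c$ and the convention that $p_{ij}$ is the probability of going from $j$ to $i$, its transition matrix is $$P=\begin{bmatrix}\frac12&0&0&\frac12\\ \frac12&0&0&\frac12\\ 0&1&0&0\\ 0&0&1&0\end{bmatrix},$$ and $q=(\frac14,\frac14,\frac14,\frac14)$ is $P$-stationary. Let $\mathbb{P}$ be the unique probability measure on $X$ for which the coordinate process $e_n(x)=x_n$ satisfies $\mathbb{P}[e_n=i]=q_i$ and $\mathbb{P}[e_n=i\mid e_{n-1}=j]=p_{ij}$ and is the stationary Markov chain with these data. The shift $T$ on $(X,\mathbb{P})$ is a mixing measure preserving transformation. Schrödinger operator. For $x\in X$, $H_x$ acts on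 $l^2(\mathbb{Z})$ by $$[H_x\psi]_n=-(\psi_{n+1}+\psi_{n-1})+\upsilon(x_n)\,\psi_n .$$ Integrated density of states. Let $H_x^{(n)}=P_nH_xP_n^*$ be the truncation of $H_x$ to the coordinates $\{0,1,\dots,n\}$, where $P_n$ is the coordinate projection onto $\{0,\dots,n\}$. The integrated density of states is the $\mathbb{P}$-almost sure limit $$N(E)=\lim_{n\to\infty}\frac{1}{n+1}\,\#\big((-\infty,E]\cap \text{Spectrum of }H_x^{(n)}\big).$$ Modulus of continuity. For $\gamma\ge1$ and $\beta\ge1$, a function $f$ on a metric space $(Y,d)$ is $(\gamma,\beta)$-log-Hölder continuous if it has a modulus of continuity $\omega(r)=C\,e^{-\beta(\log\log\frac1r)^{\gamma}}$ for some constant $C<\infty$, i.e. $|f(x)-f(y)|\le\omega(d(x,y))$ (the formula for $\omega$ being relevant for small $r>0$). For $\gamma=1$ this is $\omega(r)=C(\log\frac1r)^{-\beta}$. Continuity with this modulus at a point $x_0$ means that, for some $C<\infty$, $|f(x)-f(x_0)|\le\omega(d(x,x_0))$ for all $x$ sufficiently close to $x_0$. Thus the claim says that for no $C<\infty$ does $|N(E)-N(0)|\le C(\log\frac1{|E|})^{-\beta}$ hold for all sufficiently small $E\neq0$. *)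

theory Defs
  imports "HOL-Probability.Probability" "Jordan_Normal_Form.Spectral_Radius"
begin

unbundle no vec_syntax
hide_const (open) Finite_Cartesian_Product.vec Finite_Cartesian_Product.mat

datatype symb = S0 | Sa | Sb | Sc

instance symb :: finite
proof
  have "(UNIV :: symb set) = {S0, Sa, Sb, Sc}"
    using symb.exhaust by blast
  then show "finite (UNIV :: symb set)"
    by (metis finite.emptyI finite_insert)
qed

lemma UNIV_symb: "(UNIV :: symb set) = {S0, Sa, Sb, Sc}"
  using symb.exhaust by blast

text \<open>\<open>trans_prob i j\<close> is the probability of going from \<open>j\<close> to \<open>i\<close>, so that the columns
  (not the rows) of the transition matrix sum to 1.\<close>

definition trans_prob :: "symb \<Rightarrow> symb \<Rightarrow> real" where
  "trans_prob i j = (case j of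
       S0 \<Rightarrow> (if i \<in> {S0, Sa} then 1/2 else 0)
     | Sa \<Rightarrow> (if i = Sb then 1 else 0)
     | Sb \<Rightarrow> (if i = Sc then 1 else 0)
     | Sc \<Rightarrow> (if i \<in> {S0, Sa} then 1/2 else 0))"

definition stat_prob :: "symb \<Rightarrow> real" where
  "stat_prob i = 1/4"

lemma trans_prob_stochastic: "(\<Sum>i\<in>UNIV. trans_prob i j) = 1"
  by (cases j) (simp_all add: UNIV_symb trans_prob_def)

lemma stat_prob_stationary: "(\<Sum>j\<in>UNIV. trans_prob i j * stat_prob j) = stat_prob i"
  by (cases i) (simp_all add: UNIV_symb trans_prob_def stat_prob_def)

text \<open>The three probabilistic clauses are the one-point marginals, the one-step transition
  probabilities, and the Markov property, the last one conditioning only on histories of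
  positive probability. They determine all cylinder probabilities, hence the measure.\<close>

definition markov_chain_measure ::
    "('s \<Rightarrow> real) \<Rightarrow> ('s \<Rightarrow> 's \<Rightarrow> real) \<Rightarrow> (int \<Rightarrow> 's) measure \<Rightarrow> bool" where
  "markov_chain_measure q p M \<longleftrightarrow>
     prob_space M \<and>
     sets M = sets (\<Pi>\<^sub>M n\<in>UNIV. count_space UNIV) \<and>
     (\<forall>n i. \<P>(x in M. x n = i) = q i) \<and>
     (\<forall>n i j. \<P>(x in M. x (n - 1) = j) > 0 \<longrightarrow>
        \<P>(x in M. x n = i \<bar> x (n - 1) = j) = p i j) \<and>
     (\<forall>m n s. m < n \<and> \<P>(x in M. \<forall>k\<in>{m..<n}. x k = s k) > 0 \<longrightarrow>
        \<P>(x in M. x n = s n \<bar> \<forall>k\<in>{m..<n}. x k = s k) =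
        \<P>(x in M. x n = s n \<bar> x (n - 1) = s (n - 1)))"

definition schroedinger :: "('s \<Rightarrow> real) \<Rightarrow> (int \<Rightarrow> 's) \<Rightarrow> (int \<Rightarrow> complex) \<Rightarrow> (int \<Rightarrow> complex)" where
  "schroedinger \<upsilon> x \<psi> = (\<lambda>n. - (\<psi> (n + 1) + \<psi> (n - 1)) + of_real (\<upsilon> (x n)) * \<psi> n)"

definition l2Z :: "(int \<Rightarrow> complex) set" where
  "l2Z = {\<psi>. (\<lambda>n. (cmod (\<psi> n))\<^sup>2) summable_on UNIV}"

lemma l2Z_shift:
  assumes "\<psi> \<in> l2Z"
  shows "(\<lambda>n. (cmod (\<psi> (n + k)))\<^sup>2) summable_on UNIV"
proof -
  have "bij (\<lambda>n::int. n + k)"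
    by (rule bij_betw_byWitness[where f' = "\<lambda>n. n - k"]) auto
  from summable_on_reindex_bij_betw[OF this, of "\<lambda>n. (cmod (\<psi> n))\<^sup>2"] assms
  show ?thesis by (simp add: l2Z_def)
qed

lemma schroedinger_l2Z:
  fixes \<upsilon> :: "'s::finite \<Rightarrow> real"
  assumes "\<psi> \<in> l2Z"
  shows "schroedinger \<upsilon> x \<psi> \<in> l2Z"
proof -
  define B where "B = Max (range (\<lambda>s. (\<upsilon> s)\<^sup>2))"
  have B: "(\<upsilon> s)\<^sup>2 \<le> B" for s
    unfolding B_def by (rule Max_ge) auto
  have three: "(a + b + c)\<^sup>2 \<le> 3 * (a\<^sup>2 + b\<^sup>2 + c\<^sup>2)" for a b c :: real
    using sum_squares_ge_zero[of "a - b" "b - c"] zero_le_power2[of "a - c"]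
    by (simp add: power2_eq_square algebra_simps)
  let ?g = "\<lambda>n. 3 * ((cmod (\<psi> (n + 1)))\<^sup>2 + (cmod (\<psi> (n + -1)))\<^sup>2 + B * (cmod (\<psi> (n + 0)))\<^sup>2)"
  have le: "(cmod (schroedinger \<upsilon> x \<psi> n))\<^sup>2 \<le> ?g n" for n
  proof -
    have "cmod (schroedinger \<upsilon> x \<psi> n)
        \<le> cmod (\<psi> (n + 1)) + cmod (\<psi> (n - 1)) + \<bar>\<upsilon> (x n)\<bar> * cmod (\<psi> n)"
      unfolding schroedinger_def
      using norm_triangle_ineq[of "- (\<psi> (n + 1) + \<psi> (n - 1))" "of_real (\<upsilon> (x n)) * \<psi> n"]
        norm_triangle_ineq[of "\<psi> (n + 1)" "\<psi> (n - 1)"]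
      unfolding norm_minus_cancel norm_mult norm_of_real by linarith
    then have "(cmod (schroedinger \<upsilon> x \<psi> n))\<^sup>2
        \<le> (cmod (\<psi> (n + 1)) + cmod (\<psi> (n - 1)) + \<bar>\<upsilon> (x n)\<bar> * cmod (\<psi> n))\<^sup>2"
      by (rule power_mono) simp
    also have "\<dots> \<le> 3 * ((cmod (\<psi> (n + 1)))\<^sup>2 + (cmod (\<psi> (n - 1)))\<^sup>2 + (\<bar>\<upsilon> (x n)\<bar> * cmod (\<psi> n))\<^sup>2)"
      by (rule three)
    also have "\<dots> \<le> ?g n"
      using mult_right_mono[OF B[of "x n"], of "(cmod (\<psi> n))\<^sup>2"] by (simp add: power_mult_distrib)
    finally show ?thesis .
  qed
  have "?g summable_on UNIV"
    by (intro summable_on_cmult_right summable_on_add l2Z_shift assms)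
  then have "(\<lambda>n. (cmod (schroedinger \<upsilon> x \<psi> n))\<^sup>2) summable_on UNIV"
    by (rule summable_on_comparison_test) (use le in auto)
  then show ?thesis by (simp add: l2Z_def)
qed

text \<open>\<open>coord_proj n\<close> is the coordinate projection of \<open>l2Z\<close> onto the coordinates
  \<open>{0..n}\<close>, and \<open>coord_emb n\<close> is its adjoint, extension by zero.\<close>

definition coord_proj :: "nat \<Rightarrow> (int \<Rightarrow> complex) \<Rightarrow> complex vec" where
  "coord_proj n \<psi> = vec (n + 1) (\<lambda>i. \<psi> (int i))"

definition coord_emb :: "nat \<Rightarrow> complex vec \<Rightarrow> (int \<Rightarrow> complex)" where
  "coord_emb n u = (\<lambda>k. if 0 \<le> k \<and> k \<le> int n then u $ nat k else 0)"

lemma coord_emb_l2Z: "coord_emb n u \<in> l2Z"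
proof -
  have "(\<lambda>k. (cmod (coord_emb n u k))\<^sup>2) summable_on {0..int n}"
    by simp
  then have "(\<lambda>k. (cmod (coord_emb n u k))\<^sup>2) summable_on UNIV"
    by (rule summable_on_cong_neutral[THEN iffD1, rotated -1]) (auto simp: coord_emb_def)
  then show ?thesis by (simp add: l2Z_def)
qed

definition schroedinger_trunc :: "('s \<Rightarrow> real) \<Rightarrow> (int \<Rightarrow> 's) \<Rightarrow> nat \<Rightarrow> complex mat" where
  "schroedinger_trunc \<upsilon> x n =
     mat (n + 1) (n + 1) (\<lambda>(i, j).
       coord_proj n (schroedinger \<upsilon> x (coord_emb n (unit_vec (n + 1) j))) $ i)"

lemma schroedinger_trunc_apply:
  assumes u: "u \<in> carrier_vec (n + 1)"
  shows "schroedinger_trunc \<upsilon> x n *\<^sub>v u = coord_proj n (schroedinger \<upsilon> x (coord_emb n u))"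
proof (rule eq_vecI)
  have emb: "coord_emb n u k = (\<Sum>j<n+1. coord_emb n (unit_vec (n + 1) j) k * u $ j)" for k
    using u by (auto simp: coord_emb_def unit_vec_def nat_less_iff sum.delta if_distrib[of "\<lambda>z. z * _"]
        cong: if_cong)
  fix i assume "i < dim_vec (coord_proj n (schroedinger \<upsilon> x (coord_emb n u)))"
  then have i: "i < n + 1" by (simp add: coord_proj_def)
  have "(schroedinger_trunc \<upsilon> x n *\<^sub>v u) $ i
      = (\<Sum>j<n+1. schroedinger \<upsilon> x (coord_emb n (unit_vec (n + 1) j)) (int i) * u $ j)"
    using i u by (auto simp: schroedinger_trunc_def coord_proj_def scalar_prod_def lessThan_atLeast0
        intro!: sum.cong)
  also have "\<dots> = schroedinger \<upsilon> x (coord_emb n u) (int i)"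
    unfolding schroedinger_def emb
    by (simp add: ring_distribs sum.distrib sum_subtractf sum_negf sum_distrib_left mult.assoc)
  finally show "(schroedinger_trunc \<upsilon> x n *\<^sub>v u) $ i
      = coord_proj n (schroedinger \<upsilon> x (coord_emb n u)) $ i"
    using i by (simp add: coord_proj_def)
qed (use u in \<open>auto simp: schroedinger_trunc_def coord_proj_def\<close>)

text \<open>The spectrum is a set of eigenvalues; the truncations are Jacobi matrices, whose
  eigenvalues are all simple, so counting with multiplicity would give the same number.\<close>

definition eigenvalue_count :: "('s \<Rightarrow> real) \<Rightarrow> (int \<Rightarrow> 's) \<Rightarrow> nat \<Rightarrow> real \<Rightarrow> nat" where
  "eigenvalue_count \<upsilon> x n E =
     card (complex_of_real ` {..E} \<inter> spectrum (schroedinger_trunc \<upsilon> x n))"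

definition integrated_density_of_states ::
    "(int \<Rightarrow> 's) measure \<Rightarrow> ('s \<Rightarrow> real) \<Rightarrow> (real \<Rightarrow> real) \<Rightarrow> bool" where
  "integrated_density_of_states M \<upsilon> N \<longleftrightarrow>
     (\<forall>E. AE x in M. (\<lambda>n. real (eigenvalue_count \<upsilon> x n E) / real (n + 1)) \<longlonglongrightarrow> N E)"

text \<open>The modulus \<open>\<omega> r = C * exp (- \<beta> * (ln (ln (1 / r))) powr \<gamma>)\<close> is meaningful only
  for small \<open>r > 0\<close> (say \<open>r < exp (-1)\<close>), hence the restriction to a punctured
  neighbourhood.\<close>

definition log_hoelder_at ::
    "real \<Rightarrow> real \<Rightarrow> ('a::metric_space \<Rightarrow> real) \<Rightarrow> 'a \<Rightarrow> bool" where
  "log_hoelder_at \<gamma> \<beta> f x0 \<longleftrightarrow>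
     (\<exists>C. \<forall>\<^sub>F x in at x0.
        \<bar>f x - f x0\<bar> \<le> C * exp (- \<beta> * (ln (ln (1 / dist x x0))) powr \<gamma>))"

definition upsilon :: "symb \<Rightarrow> real" where
  "upsilon s = (case s of S0 \<Rightarrow> 0 | Sa \<Rightarrow> - exp 1 | Sb \<Rightarrow> - exp (- 1) | Sc \<Rightarrow> - exp 1)"

end

theory Submission
  imports Defs "HOL-Real_Asymp.Real_Asymp"
begin

text \<open>
  At energy 0 the transfer matrix of the symbol \<open>0\<close> is the rotation by a right angle, and that of the
  block \<open>abc\<close> is the diagonal matrix with entries \<open>e\<close> and \<open>1/e\<close>. So a solution of \<open>H u = 0\<close> that
  starts on a coordinate axis stays on the axes, and the logarithm of its amplitude moves like
  a simple random walk. On a stretch of \<open>O(L\<^sup>2)\<close> sites the walk rises by \<open>L\<close> and then falls by \<open>L\<close> with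
  probability bounded below, and the solution cut off to such a stretch is a test function with
  \<open>norm (H g) < \<epsilon> norm g\<close> for \<open>\<epsilon> = exp (2 - L)\<close>. Test functions in disjoint stretches are orthogonal
  with orthogonal images, so they force one eigenvalue in \<open>(- \<epsilon>, \<epsilon>)\<close> each, whence \<open>N \<epsilon> - N (- \<epsilon>) \<ge> c / L\<^sup>2\<close>, while log-Hoelder
  continuity would bound this difference by a multiple of \<open>L powr - \<beta>\<close>.
\<close>

subsection \<open>Jacobi matrices\<close>

text \<open>The index is shifted by one against the sites: \<open>sol v E (Suc i)\<close> is the value at site \<open>i\<close>, and
  \<open>sol v E 0 = 0\<close> is the Dirichlet condition at site \<open>-1\<close>. Hence \<open>sol v E (Suc n) = 0\<close> says that \<open>E\<close> is
  an eigenvalue of the truncation to the \<open>n\<close> sites \<open>0, ..., n - 1\<close>.\<close>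

fun sol :: "(nat \<Rightarrow> 'a::comm_ring_1) \<Rightarrow> 'a \<Rightarrow> nat \<Rightarrow> 'a" where
  "sol v E 0 = 0"
| "sol v E (Suc 0) = 1"
| "sol v E (Suc (Suc i)) = (v i - E) * sol v E (Suc i) - sol v E i"

text \<open>The same recursion with the energy as the indeterminate, so that eigenvalues can be
  counted by degree and tested for simplicity by the derivative.\<close>

fun sol_poly :: "(nat \<Rightarrow> 'a::comm_ring_1) \<Rightarrow> nat \<Rightarrow> 'a poly" where
  "sol_poly v 0 = 0"
| "sol_poly v (Suc 0) = 1"
| "sol_poly v (Suc (Suc i)) = [:v i, -1:] * sol_poly v (Suc i) - sol_poly v i"

lemma poly_sol_poly: "poly (sol_poly v k) E = sol v E k"
  by (induction v k rule: sol_poly.induct) (simp_all add: algebra_simps)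

lemma sol_of_real:
  "sol (\<lambda>i. of_real (v i)) (of_real E) k = (of_real (sol v E k) :: 'a::{real_algebra_1,comm_ring_1})"
  by (induction v E k rule: sol.induct) simp_all

lemma sol_cnj: "sol (\<lambda>i. complex_of_real (v i)) (cnj z) k = cnj (sol (\<lambda>i. complex_of_real (v i)) z k)"
  by (induction k rule: induct_nat_012) simp_all

lemma degree_sol_poly:
  fixes v :: "nat \<Rightarrow> 'a::idom"
  shows "degree (sol_poly v (Suc k)) = k"
proof -
  have "degree (sol_poly v (Suc k)) = k \<and> degree (sol_poly v k) \<le> k \<and> sol_poly v (Suc k) \<noteq> 0"
  proof (induction k)
    case (Suc k)
    then have lin: "degree ([:v k, -1:] * sol_poly v (Suc k)) = Suc k"
      by (subst degree_mult_eq) auto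
    have "degree (sol_poly v (Suc (Suc k))) = Suc k"
    proof (cases k)
      case 0
      then show ?thesis using lin by simp
    next
      case (Suc j)
      then have "degree (- sol_poly v k) < degree ([:v k, -1:] * sol_poly v (Suc k))"
        using lin \<open>degree (sol_poly v (Suc k)) = k \<and> _\<close> by (simp del: sol_poly.simps)
      then show ?thesis
        using degree_add_eq_left[of "- sol_poly v k" "[:v k, -1:] * sol_poly v (Suc k)"] lin
        by simp
    qed
    then show ?case using Suc by (auto simp del: sol_poly.simps)
  qed simp
  then show ?thesis ..
qed

section \<open>Green's identity and the Wronskian\<close>

lemma green_identity:
  fixes f s :: "nat \<Rightarrow> 'a::comm_ring_1"
  shows "(\<Sum>i<n. (v i * f (Suc i) - f (Suc (Suc i)) - f i) * s (Suc i)) =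
    (\<Sum>i<n. f (Suc i) * (v i * s (Suc i) - s (Suc (Suc i)) - s i))
      + (f n * s (Suc n) - f (Suc n) * s n) - (f 0 * s (Suc 0) - f (Suc 0) * s 0)"
  by (induction n) (simp_all add: algebra_simps)

lemma sol_green:
  fixes f :: "nat \<Rightarrow> 'a::comm_ring_1"
  assumes "f 0 = 0"
  shows "(\<Sum>i<n. (v i * f (Suc i) - f (Suc (Suc i)) - f i) * sol v E (Suc i)) =
    E * (\<Sum>i<n. f (Suc i) * sol v E (Suc i)) + (f n * sol v E (Suc n) - f (Suc n) * sol v E n)"
  unfolding green_identity[of v f "sol v E" n] using assms
  by (simp add: algebra_simps sum_distrib_left)

text \<open>Green's identity for two solutions. If both vanish at \<open>Suc n\<close>, the
  right-hand side is 0: this gives the orthogonality of eigenvectors and, for conjugate energies,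
  the reality of eigenvalues.\<close>

lemma sol_christoffel_darboux:
  "(F - E) * (\<Sum>i<n. sol v F (Suc i) * sol v E (Suc i)) =
    sol v F n * sol v E (Suc n) - sol v F (Suc n) * sol v E n"
proof -
  have "v i * sol v F (Suc i) - sol v F (Suc (Suc i)) - sol v F i = F * sol v F (Suc i)" for i
    by (simp add: algebra_simps)
  then show ?thesis
    using sol_green[of "sol v F" v E n]
    by (simp add: algebra_simps sum_subtractf flip: sum_distrib_left)
qed

text \<open>The limit of the Christoffel-Darboux formula as \<open>F\<close> tends to
  \<open>E\<close>, in algebraic form. At a double root the left-hand side would vanish, which the
  sum of squares forbids for real \<open>E\<close> and \<open>n > 0\<close>.\<close>

lemma sol_wronskian:
  fixes v :: "nat \<Rightarrow> 'a::idom"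
  shows "poly (pderiv (sol_poly v (Suc n))) E * sol v E n - poly (pderiv (sol_poly v n)) E * sol v E (Suc n)
    = - (\<Sum>i<n. (sol v E (Suc i))\<^sup>2)"
proof (induction n)
  case (Suc n)
  have rec: "poly (pderiv (sol_poly v (Suc (Suc n)))) E =
      (v n - E) * poly (pderiv (sol_poly v (Suc n))) E - sol v E (Suc n) - poly (pderiv (sol_poly v n)) E"
    by (simp only: sol_poly.simps pderiv_mult pderiv_diff)
      (simp add: pderiv_pCons poly_sol_poly algebra_simps)
  show ?case
    unfolding rec using Suc by (simp add: algebra_simps power2_eq_square del: sol_poly.simps)
qed (simp add: pderiv_1)

lemma sol_norm_pos:
  fixes v :: "nat \<Rightarrow> real"
  assumes "n > 0"
  shows "(\<Sum>i<n. (sol v E (Suc i))\<^sup>2) > 0"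
  using assms by (intro sum_pos2[of _ 0]) auto

lemma sol_root_real:
  fixes v :: "nat \<Rightarrow> real"
  assumes "n > 0" and root: "sol (\<lambda>i. complex_of_real (v i)) z (Suc n) = 0"
  shows "z \<in> \<real>"
proof -
  let ?v = "\<lambda>i. complex_of_real (v i)"
  have "(cnj z - z) * (\<Sum>i<n. sol ?v (cnj z) (Suc i) * sol ?v z (Suc i)) = 0"
    unfolding sol_christoffel_darboux using root sol_cnj[of v z] by simp
  moreover have "(\<Sum>i<n. sol ?v (cnj z) (Suc i) * sol ?v z (Suc i))
      = of_real (\<Sum>i<n. (cmod (sol ?v z (Suc i)))\<^sup>2)"
    unfolding sol_cnj of_real_sum by (intro sum.cong refl) (metis complex_norm_square mult.commute)
  moreover have "(\<Sum>i<n. (cmod (sol ?v z (Suc i)))\<^sup>2) > 0"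
    using assms(1) by (intro sum_pos2[of _ 0]) auto
  ultimately have "cnj z = z" by (simp del: of_real_sum)
  then show ?thesis by (simp add: Reals_cnj_iff)
qed

text \<open>Over the complex numbers a square-free polynomial of degree \<open>n\<close> has
  \<open>n\<close> roots; they are simple by \<open>sol_wronskian\<close> and real by
  \<open>sol_root_real\<close>.\<close>

lemma card_sol_roots:
  fixes v :: "nat \<Rightarrow> real"
  assumes n: "n > 0"
  shows "card {E. sol v E (Suc n) = 0} = n"
proof -
  let ?v = "\<lambda>i. complex_of_real (v i)"
  let ?p = "sol_poly ?v (Suc n)"
  have "complex_of_real ` {E. sol v E (Suc n) = 0} = {z. poly ?p z = 0}"
  proof (intro equalityI subsetI)
    fix z assume "z \<in> {z. poly ?p z = 0}"
    then have s0: "sol ?v z (Suc n) = 0" by (simp add: poly_sol_poly del: sol.simps)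
    then obtain E where "z = of_real E" using sol_root_real[OF n] Reals_cases by metis
    then show "z \<in> complex_of_real ` {E. sol v E (Suc n) = 0}"
      using s0 by (simp add: sol_of_real del: sol.simps)
  qed (auto simp: poly_sol_poly sol_of_real simp del: sol.simps)
  then have "card {z. poly ?p z = 0} = card {E. sol v E (Suc n) = 0}"
    by (metis card_image inj_of_real inj_on_subset subset_UNIV)
  moreover have "rsquarefree ?p"
    unfolding rsquarefree_roots
  proof (intro allI notI)
    fix z assume z: "poly ?p z = 0 \<and> poly (pderiv ?p) z = 0"
    then have s0: "sol ?v z (Suc n) = 0" by (simp add: poly_sol_poly del: sol.simps)
    then obtain E where E: "z = of_real E" using sol_root_real[OF n] Reals_cases by metis
    have "(\<Sum>i<n. (sol ?v z (Suc i))\<^sup>2) = 0"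
      using sol_wronskian[of ?v n z] z s0 by simp
    then have "complex_of_real (\<Sum>i<n. (sol v E (Suc i))\<^sup>2) = 0"
      unfolding E sol_of_real by simp
    then show False using sol_norm_pos[OF n, of v E] by (simp only: of_real_eq_0_iff)
  qed
  moreover have "?p \<noteq> 0" using n degree_sol_poly[of ?v n] by (metis degree_0 less_irrefl)
  ultimately show ?thesis using rsquarefree_card_degree[of ?p] degree_sol_poly[of ?v n] by simp
qed

text \<open>The normalised eigenvectors are the rows of \<open>Q\<close>. By
  \<open>card_sol_roots\<close> this matrix is square, so orthonormal rows imply orthonormal
  columns, which is completeness of the eigenvectors.\<close>

lemma sol_parseval:
  fixes v f :: "nat \<Rightarrow> real"
  assumes n: "n > 0"
  shows "(\<Sum>i<n. (f i)\<^sup>2) = (\<Sum>E | sol v E (Suc n) = 0.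
    (\<Sum>i<n. f i * sol v E (Suc i))\<^sup>2 / (\<Sum>i<n. (sol v E (Suc i))\<^sup>2))"
proof -
  let ?R = "{E. sol v E (Suc n) = 0}"
  define nm where "nm E = sqrt (\<Sum>i<n. (sol v E (Suc i))\<^sup>2)" for E
  have nm: "nm E > 0" "(nm E)\<^sup>2 = (\<Sum>i<n. (sol v E (Suc i))\<^sup>2)" for E
    using sol_norm_pos[OF n, of v E] by (simp_all add: nm_def)
  have card: "card ?R = n" by (rule card_sol_roots[OF n])
  then have "finite ?R" using n by (metis card.infinite less_irrefl)
  then obtain r where r: "bij_betw r {..<n} ?R"
    using ex_bij_betw_nat_finite[of ?R] card by (auto simp: atLeast0LessThan)
  define Q where "Q = mat n n (\<lambda>(a, i). sol v (r a) (Suc i) / nm (r a))"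
  have Q: "Q \<in> carrier_mat n n" by (simp add: Q_def)
  have "Q * transpose_mat Q = 1\<^sub>m n"
  proof (rule eq_matI)
    fix a b assume "a < dim_row (1\<^sub>m n)" "b < dim_col (1\<^sub>m n)"
    then have ab: "a < n" "b < n" by auto
    then have "(Q * transpose_mat Q) $$ (a, b)
        = (\<Sum>i<n. sol v (r a) (Suc i) * sol v (r b) (Suc i)) / (nm (r a) * nm (r b))"
      by (simp add: Q_def scalar_prod_def lessThan_atLeast0 sum_divide_distrib)
    also have "\<dots> = (if a = b then 1 else 0)"
    proof (cases "a = b")
      case True
      then have "(\<Sum>i<n. sol v (r a) (Suc i) * sol v (r b) (Suc i)) = nm (r a) * nm (r b)"
        using nm(2)[of "r b"] by (simp add: power2_eq_square)
      then show ?thesis using True nm(1)[of "r b"] by simp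
    next
      case False
      then have "r a \<noteq> r b" using r ab by (auto simp: bij_betw_def inj_on_def)
      moreover have "sol v (r a) (Suc n) = 0" "sol v (r b) (Suc n) = 0"
        using r ab unfolding bij_betw_def by blast+
      ultimately have "(\<Sum>i<n. sol v (r a) (Suc i) * sol v (r b) (Suc i)) = 0"
        using sol_christoffel_darboux[of "r a" "r b" v n] by simp
      then show ?thesis using False by simp
    qed
    finally show "(Q * transpose_mat Q) $$ (a, b) = 1\<^sub>m n $$ (a, b)" using ab by simp
  qed (auto simp: Q_def)
  then have QQ: "transpose_mat Q * Q = 1\<^sub>m n"
    using mat_mult_left_right_inverse[of Q n "transpose_mat Q"] Q by simp
  have orth: "(\<Sum>a<n. Q $$ (a, i) * Q $$ (a, j)) = (if i = j then 1 else 0)"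
    if "i < n" "j < n" for i j
    using arg_cong[OF QQ, of "\<lambda>A. A $$ (i, j)"] that Q
    by (simp add: scalar_prod_def lessThan_atLeast0)
  have "(\<Sum>E\<in>?R. (\<Sum>i<n. f i * sol v E (Suc i))\<^sup>2 / (\<Sum>i<n. (sol v E (Suc i))\<^sup>2))
      = (\<Sum>a<n. (\<Sum>i<n. f i * sol v (r a) (Suc i))\<^sup>2 / (nm (r a))\<^sup>2)"
    unfolding nm by (rule sum.reindex_bij_betw[OF r, symmetric])
  also have "\<dots> = (\<Sum>a<n. (\<Sum>i<n. f i * Q $$ (a, i))\<^sup>2)"
  proof (rule sum.cong[OF refl])
    fix a assume "a \<in> {..<n}"
    then have "(\<Sum>i<n. f i * Q $$ (a, i)) = (\<Sum>i<n. f i * sol v (r a) (Suc i)) / nm (r a)"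
      unfolding Q_def sum_divide_distrib by (intro sum.cong) auto
    then show "(\<Sum>i<n. f i * sol v (r a) (Suc i))\<^sup>2 / (nm (r a))\<^sup>2 = (\<Sum>i<n. f i * Q $$ (a, i))\<^sup>2"
      by (simp add: power_divide)
  qed
  also have "\<dots> = (\<Sum>a<n. \<Sum>i<n. \<Sum>j<n. f i * f j * (Q $$ (a, i) * Q $$ (a, j)))"
    unfolding power2_eq_square sum_product by (simp add: algebra_simps)
  also have "\<dots> = (\<Sum>i<n. \<Sum>a<n. \<Sum>j<n. f i * f j * (Q $$ (a, i) * Q $$ (a, j)))"
    by (rule sum.swap)
  also have "\<dots> = (\<Sum>i<n. \<Sum>j<n. f i * f j * (\<Sum>a<n. Q $$ (a, i) * Q $$ (a, j)))"
    unfolding sum_distrib_left by (intro sum.cong refl sum.swap)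
  also have "\<dots> = (\<Sum>i<n. (f i)\<^sup>2)"
    by (simp add: orth power2_eq_square if_distrib sum.delta cong: if_cong)
  finally show ?thesis ..
qed

text \<open>Gaussian elimination: \<open>k0\<close> is a pivot for the equation \<open>l0\<close>,
  \<open>?m\<close> is the system left for the other unknowns, and \<open>c\<close> is the value of
  the pivot unknown that solves \<open>l0\<close>.\<close>

lemma underdetermined_system:
  fixes m :: "'k \<Rightarrow> 'l \<Rightarrow> 'a::field"
  assumes "finite \<Lambda>" "finite G" "card \<Lambda> < card G"
  shows "\<exists>a. (\<exists>k\<in>G. a k \<noteq> 0) \<and> (\<forall>l\<in>\<Lambda>. (\<Sum>k\<in>G. a k * m k l) = 0)"
  using assms
proof (induction \<Lambda> arbitrary: G m)
  case empty
  then have "G \<noteq> {}" by auto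
  then show ?case by (intro exI[of _ "\<lambda>_. 1"]) auto
next
  case (insert l0 \<Lambda>)
  show ?case
  proof (cases "\<forall>k\<in>G. m k l0 = 0")
    case True
    obtain a where "\<exists>k\<in>G. a k \<noteq> 0" "\<forall>l\<in>\<Lambda>. (\<Sum>k\<in>G. a k * m k l) = 0"
      using insert.IH[of G m] insert.prems insert.hyps by auto
    with True show ?thesis by (intro exI[of _ a]) auto
  next
    case False
    then obtain k0 where k0: "k0 \<in> G" "m k0 l0 \<noteq> 0" by auto
    let ?m = "\<lambda>k l. m k l - m k l0 / m k0 l0 * m k0 l"
    have "card \<Lambda> < card (G - {k0})" using insert.prems insert.hyps k0 by simp
    then obtain a where a: "\<exists>k\<in>G - {k0}. a k \<noteq> 0" "\<forall>l\<in>\<Lambda>. (\<Sum>k\<in>G - {k0}. a k * ?m k l) = 0"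
      using insert.IH[of "G - {k0}" ?m] insert.prems by auto
    define c where "c = - (\<Sum>k\<in>G - {k0}. a k * m k l0) / m k0 l0"
    have eq: "(\<Sum>k\<in>G. (a(k0 := c)) k * m k l) = (\<Sum>k\<in>G - {k0}. a k * ?m k l)" for l
    proof -
      have "(\<Sum>k\<in>G. (a(k0 := c)) k * m k l) = c * m k0 l + (\<Sum>k\<in>G - {k0}. a k * m k l)"
        using k0 insert.prems by (simp add: sum.remove[of G k0])
      also have "\<dots> = (\<Sum>k\<in>G - {k0}. a k * ?m k l)"
        by (simp add: c_def algebra_simps sum_subtractf sum_distrib_left sum_distrib_right sum_divide_distrib)
      finally show ?thesis .
    qed
    have "(\<Sum>k\<in>G - {k0}. a k * ?m k l0) = 0" using k0 by simp
    then have "\<forall>l\<in>insert l0 \<Lambda>. (\<Sum>k\<in>G. (a(k0 := c)) k * m k l) = 0"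
      using a(2) unfolding eq by auto
    moreover have "\<exists>k\<in>G. (a(k0 := c)) k \<noteq> 0" using a(1) by auto
    ultimately show ?thesis by blast
  qed
qed

subsection \<open>Simple random walk\<close>

text \<open>The factor \<open>2 * n + 1\<close> makes the induction close: consecutive left-hand
  sides have ratio at most 16 because \<open>(2 * n + 3) * (2 * n + 1)\<close> is at most
  \<open>4 * (n + 1)^2\<close>.\<close>

lemma central_binomial_upper: "(2 * real n + 1) * (real ((2 * n) choose n))\<^sup>2 \<le> 16 ^ n"
proof (induction n)
  case (Suc n)
  define c where "c = real ((2 * n) choose n)"
  have "Suc n * ((2 * Suc n) choose Suc n) = 2 * (2 * n + 1) * ((2 * n) choose n)"
  proof -
    have "(2 * Suc n) choose Suc n = 2 * (Suc (2 * n) choose n)"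
      using binomial_symmetric[of n "Suc (2 * n)"] by simp
    then have "Suc n * ((2 * Suc n) choose Suc n) = 2 * (Suc n * (Suc (2 * n) choose n))"
      by simp
    also have "Suc (2 * n) choose n = Suc (2 * n) choose Suc n"
      using binomial_symmetric[of n "Suc (2 * n)"] by simp
    also have "Suc n * (Suc (2 * n) choose Suc n) = Suc (2 * n) * ((2 * n) choose n)"
      using Suc_times_binomial_eq[of "2 * n" n] by simp
    finally show ?thesis by simp
  qed
  then have "real (Suc n) * real ((2 * Suc n) choose Suc n) = 2 * (2 * real n + 1) * c"
    unfolding c_def by (metis (mono_tags, lifting) of_nat_1 of_nat_add of_nat_mult of_nat_numeral)
  then have rec: "real ((2 * Suc n) choose Suc n) = 2 * (2 * real n + 1) * c / (real n + 1)"
    by (simp add: field_simps)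
  have "(2 * real (Suc n) + 1) * (real ((2 * Suc n) choose Suc n))\<^sup>2
      = 4 * ((2 * real n + 3) * (2 * real n + 1) / (real n + 1)\<^sup>2) * ((2 * real n + 1) * c\<^sup>2)"
    unfolding rec by (simp add: power_divide power_mult_distrib power2_eq_square algebra_simps)
  also have "\<dots> \<le> 4 * 4 * 16 ^ n"
  proof (intro mult_mono)
    have "(2 * real n + 3) * (2 * real n + 1) \<le> 4 * (real n + 1)\<^sup>2"
      by (simp add: power2_eq_square algebra_simps)
    then show "(2 * real n + 3) * (2 * real n + 1) / (real n + 1)\<^sup>2 \<le> 4"
      by (subst divide_le_eq) auto
    show "(2 * real n + 1) * c\<^sup>2 \<le> 16 ^ n" using Suc unfolding c_def .
  qed auto
  finally show ?case by simp
qed simp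

definition sgb :: "bool \<Rightarrow> int" where
  "sgb t = (if t then 1 else - 1)"

definition walk :: "bool list \<Rightarrow> int" where
  "walk ts = sum_list (map sgb ts)"

lemma walk_simps [simp]:
  "walk [] = 0" "walk (t # ts) = sgb t + walk ts" "walk (ts @ us) = walk ts + walk us"
  by (simp_all add: walk_def)

lemma finite_bool_lists: "finite {ts :: bool list. length ts = n \<and> P ts}"
  by (rule finite_subset[OF _ finite_list_length[of n]]) auto

lemma card_bool_lists: "card {ts :: bool list. length ts = n} = 2 ^ n"
  using card_lists_length_eq[of "UNIV :: bool set" n] by simp

text \<open>\<open>j\<close> is the number of steps up; splitting off the first step gives Pascal's
  rule.\<close>

lemma card_walk_eq: "card {ts. length ts = n \<and> walk ts = 2 * int j - int n} = n choose j"
proof (induction n arbitrary: j)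
  case 0
  have "{ts. length ts = 0 \<and> walk ts = 2 * int j - int 0} = (if j = 0 then {[]} else {})" by auto
  then show ?case by simp
next
  case (Suc n)
  let ?S = "\<lambda>n z. {ts. length ts = n \<and> walk ts = z}"
  have dec: "?S (Suc n) z = Cons True ` ?S n (z - 1) \<union> Cons False ` ?S n (z + 1)" for z
    by (auto simp: length_Suc_conv sgb_def image_iff)
  have "card (?S (Suc n) z) = card (?S n (z - 1)) + card (?S n (z + 1))" for z
    unfolding dec by (subst card_Un_disjoint) (auto simp: finite_bool_lists card_image inj_on_def)
  moreover have "card (?S n (2 * int j - int (Suc n) - 1)) = (if j = 0 then 0 else n choose (j - 1))"
  proof (cases j)
    case 0
    have lb: "walk ts \<ge> - int (length ts)" for ts
      by (induction ts) (auto simp: sgb_def)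
    have "walk ts \<noteq> 2 * int j - int (Suc n) - 1" if "length ts = n" for ts
      using lb[of ts] that 0 by simp
    then have "?S n (2 * int j - int (Suc n) - 1) = {}" by blast
    then show ?thesis using 0 by (simp only: card.empty simp_thms if_True)
  next
    case (Suc i)
    then show ?thesis using Suc.IH[of i] by (simp add: algebra_simps)
  qed
  moreover have "card (?S n (2 * int j - int (Suc n) + 1)) = n choose j"
    using Suc.IH[of j] by (simp add: algebra_simps)
  ultimately show ?case by (cases j) simp_all
qed

lemma walk_eq_ex:
  obtains j where "j \<le> length ts" "walk ts = 2 * int j - int (length ts)"
proof -
  have "\<exists>j \<le> length ts. walk ts = 2 * int j - int (length ts)"
  proof (induction ts)
    case (Cons t ts)
    then obtain j where "j \<le> length ts" "walk ts = 2 * int j - int (length ts)" by blast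
    then show ?case
      by (intro exI[of _ "if t then Suc j else j"]) (auto simp: sgb_def)
  qed simp
  then show ?thesis using that by blast
qed

lemma walk_map_Not: "walk (map Not ts) = - walk ts"
  by (induction ts) (auto simp: sgb_def)

lemma card_walk_le:
  "card {ts. length ts = n \<and> walk ts \<le> - z} = card {ts. length ts = n \<and> walk ts \<ge> z}"
  by (rule bij_betw_same_card[of "map Not"], rule bij_betw_byWitness[where f' = "map Not"])
    (auto simp: walk_map_Not o_def)

text \<open>The range strictly between \<open>- L\<close> and \<open>L\<close> is covered by
  \<open>2 * L\<close> values of \<open>j\<close>, each taken by at most
  \<open>(2 * n) choose n\<close> paths. With the factor 8 one has \<open>(4 * L)^2 = 2 * n\<close>,
  so this is at most half of all paths; the two tails are equal by symmetry.\<close>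

lemma card_walk_ge:
  fixes L :: nat
  assumes n: "n = 8 * L\<^sup>2"
  shows "4 * card {ts. length ts = 2 * n \<and> walk ts \<ge> int L} \<ge> 4 ^ n"
proof (cases "L = 0")
  case True
  then have "{ts. length ts = 2 * n \<and> walk ts \<ge> int L} = {[]}" using assms by auto
  then show ?thesis using True assms by simp
next
  case False
  let ?A = "{ts. length ts = 2 * n \<and> walk ts \<ge> int L}"
  let ?B = "{ts. length ts = 2 * n \<and> walk ts \<le> - int L}"
  let ?C = "{ts. length ts = 2 * n \<and> \<bar>walk ts\<bar> < int L}"
  let ?D = "\<lambda>j. {ts. length ts = 2 * n \<and> walk ts = 2 * int j - int (2 * n)}"
  have "?C \<subseteq> (\<Union>j\<in>{n - L..<n + L}. ?D j)"
  proof
    fix ts assume ts: "ts \<in> ?C"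
    obtain j where j: "walk ts = 2 * int j - int (length ts)" using walk_eq_ex by blast
    then have "j \<in> {n - L..<n + L}" using ts by auto
    then show "ts \<in> (\<Union>j\<in>{n - L..<n + L}. ?D j)" using ts j by auto
  qed
  then have "card ?C \<le> card (\<Union>j\<in>{n - L..<n + L}. ?D j)"
    by (intro card_mono) (auto intro: finite_bool_lists)
  also have "\<dots> \<le> (\<Sum>j\<in>{n - L..<n + L}. card (?D j))"
    by (rule card_UN_le) simp
  also have "\<dots> \<le> (\<Sum>j\<in>{n - L..<n + L}. (2 * n) choose n)"
    unfolding card_walk_eq by (intro sum_mono binomial_maximum')
  also have "\<dots> \<le> 2 * L * ((2 * n) choose n)" by simp
  finally have C: "real (card ?C) \<le> 2 * real L * real ((2 * n) choose n)"
    by (metis (mono_tags, lifting) of_nat_le_iff of_nat_mult of_nat_numeral)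
  have "(4 * real L * real ((2 * n) choose n))\<^sup>2 = (2 * real n) * (real ((2 * n) choose n))\<^sup>2"
    by (simp add: n power_mult_distrib)
  also have "\<dots> \<le> (2 * real n + 1) * (real ((2 * n) choose n))\<^sup>2"
    by (intro mult_right_mono) auto
  also have "\<dots> \<le> 16 ^ n" by (rule central_binomial_upper)
  also have "\<dots> = (4 ^ n)\<^sup>2" by (simp add: power2_eq_square flip: power_mult_distrib)
  finally have "4 * real L * real ((2 * n) choose n) \<le> 4 ^ n"
    by (rule power2_le_imp_le) simp
  with C have C': "2 * real (card ?C) \<le> 4 ^ n" by linarith
  have "4 ^ n = card {ts :: bool list. length ts = 2 * n}"
    by (simp add: card_bool_lists power_mult)
  also have "{ts :: bool list. length ts = 2 * n} = ?A \<union> ?B \<union> ?C" by auto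
  also have "card (?A \<union> ?B \<union> ?C) \<le> card ?A + card ?B + card ?C"
    using card_Un_le[of "?A \<union> ?B" ?C] card_Un_le[of ?A ?B] by linarith
  also have "card ?B = card ?A" by (rule card_walk_le)
  finally have "real (4 ^ n) \<le> real (card ?A + card ?A + card ?C)" by (rule of_nat_mono)
  then have "real (4 ^ n) \<le> real (4 * card ?A)" using C' by simp
  then show ?thesis by (simp only: of_nat_le_iff)
qed

subsection \<open>Eigenvalues from test functions\<close>

lemma sum_blocks:
  fixes \<phi> :: "nat \<Rightarrow> 'a::comm_monoid_add"
  assumes "K * B \<le> n" "\<And>i. K * B \<le> i \<Longrightarrow> \<phi> i = 0"
  shows "(\<Sum>i<n. \<phi> i) = (\<Sum>k<K. \<Sum>j<B. \<phi> (k * B + j))"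
proof -
  have "(\<Sum>i<n. \<phi> i) = (\<Sum>i<K * B. \<phi> i)"
    using assms by (intro sum.mono_neutral_right) auto
  also have "\<dots> = (\<Sum>k<K. sum \<phi> {k * B..<k * B + B})"
    by (rule sum.nat_group[symmetric])
  also have "\<dots> = (\<Sum>k<K. \<Sum>j<B. \<phi> (k * B + j))"
  proof (rule sum.cong[OF refl])
    fix k
    show "sum \<phi> {k * B..<k * B + B} = (\<Sum>j<B. \<phi> (k * B + j))"
      using sum.shift_bounds_nat_ivl[of \<phi> 0 "k * B" B]
      by (simp add: lessThan_atLeast0 add.commute)
  qed
  finally show ?thesis .
qed

text \<open>\<open>g k\<close> is a test function on the block of sites \<open>k * B, ..., k * B + B - 1\<close>. It vanishes at both ends
  of the block, so that the operator maps it to a function on the same block; at \<open>j = 0\<close> the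
  truncated \<open>j - 1\<close> is harmless because \<open>g k 0 = 0\<close>.\<close>

lemma card_small_eigenvalues_ge:
  fixes v :: "nat \<Rightarrow> real" and g :: "nat \<Rightarrow> nat \<Rightarrow> real"
  assumes n: "K * B \<le> n" and G: "G \<subseteq> {..<K}"
    and g0: "\<And>k. k \<in> G \<Longrightarrow> g k 0 = 0"
    and gB: "\<And>k j. k \<in> G \<Longrightarrow> B \<le> Suc j \<Longrightarrow> g k j = 0"
    and small: "\<And>k. k \<in> G \<Longrightarrow>
      (\<Sum>j<B. (v (k * B + j) * g k j - g k (Suc j) - g k (j - 1))\<^sup>2) < \<epsilon>\<^sup>2 * (\<Sum>j<B. (g k j)\<^sup>2)"
    and \<epsilon>: "\<epsilon> > 0"
  shows "card G \<le> card {E. sol v E (Suc n) = 0 \<and> \<bar>E\<bar> < \<epsilon>}"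
proof (cases "G = {}")
  case False
  then obtain k0 where k0: "k0 \<in> G" by blast
  have B: "B > 0" using small[OF k0] by (cases B) auto
  have "K > 0" using k0 G by auto
  then have "n > 0" using n B by (metis gr0I mult_is_0 le_zero_eq less_irrefl)
  let ?R = "{E. sol v E (Suc n) = 0}"
  let ?L = "{E. sol v E (Suc n) = 0 \<and> \<bar>E\<bar> < \<epsilon>}"
  have finR: "finite ?R" using card_sol_roots[OF \<open>n > 0\<close>, of v] \<open>n > 0\<close> by (metis card.infinite less_irrefl)
  have finG: "finite G" using G finite_subset by blast
  show ?thesis
  proof (rule ccontr)
    \<comment> \<open>With fewer small eigenvalues than test functions, some nonzero combination is
      orthogonal to all the corresponding eigenvectors. The operator then multiplies its norm by at
      least \<epsilon>, against \<open>small\<close>.\<close>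
    assume "\<not> card G \<le> card ?L"
    then have "card ?L < card G" by simp
    moreover have "finite ?L" using finR by (rule finite_subset[rotated]) auto
    ultimately obtain a where a: "\<exists>k\<in>G. a k \<noteq> 0"
      "\<forall>E\<in>?L. (\<Sum>k\<in>G. a k * (\<Sum>j<B. g k j * sol v E (Suc (k * B + j)))) = 0"
      using underdetermined_system[of ?L G "\<lambda>k E. \<Sum>j<B. g k j * sol v E (Suc (k * B + j))"] finG
      by blast
    \<comment> \<open>\<open>h\<close> is the combination as a function of the site, and
      \<open>f\<close> is \<open>h\<close> in the shifted indexing of \<open>sol\<close>.\<close>
    define h where "h i = (if i div B \<in> G then a (i div B) * g (i div B) (i mod B) else 0)" for i
    define f where "f = case_nat 0 h"
    have f_simps [simp]: "f 0 = 0" "f (Suc i) = h i" for i by (simp_all add: f_def)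
    have h_block: "h (k * B + j) = (if k \<in> G then a k * g k j else 0)" if "j < B" for k j
      using that B by (simp add: h_def)
    have h_out: "h i = 0" if "K * B \<le> i" for i
    proof -
      have "K \<le> i div B" using that B by (simp add: less_eq_div_iff_mult_less_eq)
      then show ?thesis using G by (auto simp: h_def)
    qed
    have h_start: "h (k * B) = 0" for k using h_block[of 0 k] B g0 by simp
    have h_end: "f (k * B) = 0" for k
    proof (cases k)
      case (Suc k')
      have kB: "k * B = Suc (k' * B + (B - 1))" using Suc B by simp
      have "h (k' * B + (B - 1)) = 0" using h_block[of "B - 1" k'] B gB[of k' "B - 1"] by simp
      then show ?thesis by (simp only: kB f_simps)
    qed simp
    \<comment> \<open>The image of \<open>h\<close> under the operator.\<close>
    define r where "r i = v i * f (Suc i) - f (Suc (Suc i)) - f i" for i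
    have r_block: "r (k * B + j) = (if k \<in> G then a k * (v (k * B + j) * g k j - g k (Suc j) - g k (j - 1)) else 0)"
      if j: "j < B" for k j
    proof -
      have "h (Suc (k * B + j)) = (if k \<in> G then a k * g k (Suc j) else 0)"
      proof (cases "Suc j < B")
        case True
        then show ?thesis using h_block[of "Suc j" k] by simp
      next
        case False
        then have "Suc (k * B + j) = Suc k * B" using j by simp
        then have "h (Suc (k * B + j)) = 0" by (simp only: h_start)
        then show ?thesis using gB[of k "Suc j"] False by simp
      qed
      moreover have "f (k * B + j) = (if k \<in> G then a k * g k (j - 1) else 0)"
      proof (cases j)
        case 0
        then show ?thesis using h_end[of k] g0[of k] by simp
      next
        case (Suc i)
        then show ?thesis using h_block[of i k] j by simp
      qed
      ultimately show ?thesis using h_block[OF j, of k] by (simp add: r_def algebra_simps)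
    qed
    have r_out: "r i = 0" if "K * B \<le> i" for i
    proof -
      \<comment> \<open>The site \<open>K * B\<close> still sees the last site of the last block,
        where the test functions vanish.\<close>
      have "f i = 0"
      proof (cases "i = K * B")
        case True
        then show ?thesis using h_end by simp
      next
        case False
        then have "K * B < i" using that by simp
        then obtain i' where "i = Suc i'" "K * B \<le> i'" by (metis less_imp_Suc_add le_add1)
        then show ?thesis using h_out by simp
      qed
      then show ?thesis using that h_out by (simp add: r_def)
    qed
    define c where "c E = (\<Sum>i<n. f (Suc i) * sol v E (Suc i))" for E
    define nm where "nm E = (\<Sum>i<n. (sol v E (Suc i))\<^sup>2)" for E
    have nm: "nm E > 0" for E unfolding nm_def by (rule sol_norm_pos[OF \<open>n > 0\<close>])
    have block_sum: "(\<Sum>i<n. \<phi> i) = (\<Sum>k\<in>G. \<Sum>j<B. \<psi> k j)"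
      if "\<And>i. K * B \<le> i \<Longrightarrow> \<phi> i = 0"
        "\<And>k j. j < B \<Longrightarrow> \<phi> (k * B + j) = (if k \<in> G then \<psi> k j else 0)"
      for \<phi> :: "nat \<Rightarrow> real" and \<psi>
    proof -
      have "(\<Sum>i<n. \<phi> i) = (\<Sum>k<K. \<Sum>j<B. \<phi> (k * B + j))"
        by (rule sum_blocks[OF n that(1)])
      also have "\<dots> = (\<Sum>k<K. if k \<in> G then \<Sum>j<B. \<psi> k j else 0)"
        by (intro sum.cong) (simp_all add: that(2))
      also have "\<dots> = (\<Sum>k\<in>G. \<Sum>j<B. \<psi> k j)"
        using G by (simp add: sum.inter_restrict[symmetric] inf.absorb2)
      finally show ?thesis .
    qed
    have c_zero: "c E = 0" if "E \<in> ?L" for E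
    proof -
      have "c E = (\<Sum>k\<in>G. \<Sum>j<B. a k * g k j * sol v E (Suc (k * B + j)))"
        unfolding c_def by (rule block_sum) (auto simp: h_out h_block)
      also have "\<dots> = (\<Sum>k\<in>G. a k * (\<Sum>j<B. g k j * sol v E (Suc (k * B + j))))"
        by (simp add: sum_distrib_left mult.assoc)
      finally show ?thesis using a(2) that by simp
    qed
    \<comment> \<open>At a root both boundary terms of Green's identity vanish, the second one since
      \<open>h n = 0\<close>.\<close>
    have c_r: "(\<Sum>i<n. r i * sol v E (Suc i)) = E * c E" if "E \<in> ?R" for E
      using sol_green[of f v E n] that h_out[OF n] unfolding r_def c_def by simp
    have "(\<Sum>i<n. (r i)\<^sup>2) = (\<Sum>E\<in>?R. (E * c E)\<^sup>2 / nm E)"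
      unfolding sol_parseval[OF \<open>n > 0\<close>, of r v] nm_def using c_r by (intro sum.cong) auto
    moreover have "(\<Sum>i<n. (h i)\<^sup>2) = (\<Sum>E\<in>?R. (c E)\<^sup>2 / nm E)"
      unfolding sol_parseval[OF \<open>n > 0\<close>, of h v] nm_def c_def by simp
    ultimately have "(\<Sum>i<n. (r i)\<^sup>2) - \<epsilon>\<^sup>2 * (\<Sum>i<n. (h i)\<^sup>2)
        = (\<Sum>E\<in>?R. (E\<^sup>2 - \<epsilon>\<^sup>2) * ((c E)\<^sup>2 / nm E))"
      by (simp add: sum_distrib_left sum_subtractf algebra_simps power_mult_distrib)
    also have "\<dots> \<ge> 0"
    proof (rule sum_nonneg)
      fix E assume E: "E \<in> ?R"
      show "(E\<^sup>2 - \<epsilon>\<^sup>2) * ((c E)\<^sup>2 / nm E) \<ge> 0"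
      proof (cases "\<bar>E\<bar> < \<epsilon>")
        case True
        then show ?thesis using c_zero[of E] E by simp
      next
        case False
        then have "\<epsilon>\<^sup>2 \<le> E\<^sup>2" using \<epsilon> by (metis abs_le_square_iff abs_of_pos linorder_not_le)
        then show ?thesis using nm[of E] by (intro mult_nonneg_nonneg) auto
      qed
    qed
    finally have ge: "(\<Sum>i<n. (r i)\<^sup>2) \<ge> \<epsilon>\<^sup>2 * (\<Sum>i<n. (h i)\<^sup>2)" by simp
    define X where "X k = (\<Sum>j<B. (v (k * B + j) * g k j - g k (Suc j) - g k (j - 1))\<^sup>2)" for k
    define Y where "Y k = (\<Sum>j<B. (g k j)\<^sup>2)" for k
    have "(\<Sum>i<n. (r i)\<^sup>2)
        = (\<Sum>k\<in>G. \<Sum>j<B. (a k * (v (k * B + j) * g k j - g k (Suc j) - g k (j - 1)))\<^sup>2)"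
      by (rule block_sum) (auto simp: r_out r_block)
    then have "(\<Sum>i<n. (r i)\<^sup>2) = (\<Sum>k\<in>G. (a k)\<^sup>2 * X k)"
      unfolding X_def sum_distrib_left power_mult_distrib .
    moreover have "(\<Sum>i<n. (h i)\<^sup>2) = (\<Sum>k\<in>G. \<Sum>j<B. (a k * g k j)\<^sup>2)"
      by (rule block_sum) (auto simp: h_out h_block)
    then have "(\<Sum>i<n. (h i)\<^sup>2) = (\<Sum>k\<in>G. (a k)\<^sup>2 * Y k)"
      unfolding Y_def sum_distrib_left power_mult_distrib .
    ultimately have "\<epsilon>\<^sup>2 * (\<Sum>i<n. (h i)\<^sup>2) - (\<Sum>i<n. (r i)\<^sup>2) = (\<Sum>k\<in>G. (a k)\<^sup>2 * (\<epsilon>\<^sup>2 * Y k - X k))"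
      by (simp add: sum_distrib_left sum_subtractf right_diff_distrib mult.left_commute)
    also have "\<dots> > 0"
    proof -
      obtain k where k: "k \<in> G" "a k \<noteq> 0" using a(1) by blast
      show ?thesis
      proof (rule sum_pos2[OF finG k(1)])
        show "(a k)\<^sup>2 * (\<epsilon>\<^sup>2 * Y k - X k) > 0"
          using small[OF k(1)] k(2) by (simp add: X_def Y_def)
        show "(a k)\<^sup>2 * (\<epsilon>\<^sup>2 * Y k - X k) \<ge> 0" if "k \<in> G" for k
          using small[OF that] by (simp add: X_def Y_def)
      qed
    qed
    finally show False using ge by simp
  qed
qed simp

subsection \<open>Cylinder probabilities\<close>

definition cyl :: "int \<Rightarrow> 's list \<Rightarrow> (int \<Rightarrow> 's) set" where
  "cyl m xs = {x. \<forall>i<length xs. x (m + int i) = xs ! i}"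

lemma cyl_Nil [simp]: "cyl m [] = UNIV"
  by (simp add: cyl_def)

lemma cyl_Cons: "x \<in> cyl m (a # xs) \<longleftrightarrow> x m = a \<and> x \<in> cyl (m + 1) xs"
  by (auto simp: cyl_def less_Suc_eq_0_disj algebra_simps)

lemma cyl_append: "x \<in> cyl m (xs @ ys) \<longleftrightarrow> x \<in> cyl m xs \<and> x \<in> cyl (m + int (length xs)) ys"
  by (induction xs arbitrary: m) (auto simp: cyl_Cons algebra_simps)

context
  fixes q :: "'s \<Rightarrow> real" and p :: "'s \<Rightarrow> 's \<Rightarrow> real" and M :: "(int \<Rightarrow> 's) measure"
  assumes markov: "markov_chain_measure q p M"
begin

lemma markov_prob_space: "prob_space M"
  using markov by (simp add: markov_chain_measure_def)

lemma markov_sets: "sets M = sets (\<Pi>\<^sub>M n\<in>UNIV. count_space UNIV)"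
  using markov by (simp add: markov_chain_measure_def)

lemma markov_space [simp]: "space M = UNIV"
  using sets_eq_imp_space_eq[OF markov_sets] by (simp add: space_PiM)

lemma markov_coord_sets: "{x. x n = a} \<in> sets M"
proof -
  have "(\<lambda>x. x n) \<in> measurable M (count_space UNIV)"
    unfolding measurable_cong_sets[OF markov_sets refl] by (rule measurable_component_singleton) simp
  from measurable_sets[OF this, of "{a}"] show ?thesis by (simp add: vimage_def)
qed

lemma markov_cyl_sets: "cyl m xs \<in> sets M"
proof (induction xs arbitrary: m)
  case Nil
  show ?case using sets.top[of M] by simp
next
  case (Cons a xs)
  have "cyl m (a # xs) = {x. x m = a} \<inter> cyl (m + 1) xs" by (auto simp: cyl_Cons)
  then show ?case using Cons markov_coord_sets by auto
qed

lemma markov_cyl_single: "measure M (cyl m [a]) = q a"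
proof -
  have "cyl m [a] = {x \<in> space M. x m = a}" by (auto simp: cyl_Cons)
  then show ?thesis using markov by (simp add: markov_chain_measure_def)
qed

text \<open>The Markov property with the word as the history, followed by the one-step transition
  probability.\<close>

lemma markov_cyl_snoc:
  assumes pos: "measure M (cyl m xs) > 0" and "xs \<noteq> []"
  shows "measure M (cyl m (xs @ [t])) = p t (last xs) * measure M (cyl m xs)"
proof -
  interpret prob_space M by (rule markov_prob_space)
  define n where "n = m + int (length xs)"
  \<comment> \<open>A trajectory that reads the extended word; only its values on
    \<open>{m..n}\<close> matter.\<close>
  define s where "s k = (xs @ [t]) ! nat (k - m)" for k
  have "m < n" using \<open>xs \<noteq> []\<close> by (simp add: n_def)
  have sn: "s n = t" by (simp add: s_def n_def nth_append)
  have sn1: "s (n - 1) = last xs"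
    using \<open>xs \<noteq> []\<close> by (simp add: s_def n_def nth_append last_conv_nth nat_diff_distrib')
  have hist: "(\<forall>k\<in>{m..<n}. x k = s k) \<longleftrightarrow> x \<in> cyl m xs" for x
  proof
    assume h: "\<forall>k\<in>{m..<n}. x k = s k"
    show "x \<in> cyl m xs"
      unfolding cyl_def
    proof (intro CollectI allI impI)
      fix i assume "i < length xs"
      then show "x (m + int i) = xs ! i" using h[rule_format, of "m + int i"]
        by (simp add: n_def s_def nth_append)
    qed
  next
    assume x: "x \<in> cyl m xs"
    show "\<forall>k\<in>{m..<n}. x k = s k"
    proof
      fix k assume k: "k \<in> {m..<n}"
      then have "nat (k - m) < length xs" by (auto simp: n_def)
      then have "x (m + int (nat (k - m))) = xs ! nat (k - m)" using x unfolding cyl_def by blast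
      then show "x k = s k" using k \<open>nat (k - m) < length xs\<close> by (simp add: s_def nth_append)
    qed
  qed
  have last_in: "x (n - 1) = last xs" if "x \<in> cyl m xs" for x
    using hist[of x] that \<open>m < n\<close> sn1 by auto
  \<comment> \<open>The one-step clause asks for a positive marginal, which is inherited from the
    smaller cylinder.\<close>
  have "measure M (cyl m xs) \<le> \<P>(x in M. x (n - 1) = last xs)"
    using last_in markov_coord_sets[of "n - 1" "last xs"] by (intro finite_measure_mono) auto
  then have "\<P>(x in M. x n = t \<bar> x (n - 1) = last xs) = p t (last xs)"
    using markov pos unfolding markov_chain_measure_def by fastforce
  moreover have "\<P>(x in M. \<forall>k\<in>{m..<n}. x k = s k) > 0"
    using pos unfolding hist by simp
  then have "\<P>(x in M. x n = s n \<bar> \<forall>k\<in>{m..<n}. x k = s k) = \<P>(x in M. x n = s n \<bar> x (n - 1) = s (n - 1))"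
    using markov \<open>m < n\<close> unfolding markov_chain_measure_def by blast
  ultimately have "\<P>(x in M. x n = t \<bar> x \<in> cyl m xs) = p t (last xs)"
    unfolding hist sn sn1 by simp
  moreover have "{x. x n = t \<and> x \<in> cyl m xs} = cyl m (xs @ [t])"
    by (auto simp: cyl_append cyl_Cons n_def)
  ultimately show ?thesis using pos by (simp add: cond_prob_def field_simps)
qed

end

text \<open>Words over the blocks \<open>0\<close> and \<open>abc\<close> are encoded by the signs of the increments of the random walk:
  \<open>abc\<close> keeps the axis on which the zero-energy solution lies, hence the sign, and \<open>0\<close> changes it.
  The first argument is the sign before the word.\<close>

fun code :: "bool \<Rightarrow> bool list \<Rightarrow> symb list" where
  "code b [] = []"
| "code b (t # ts) = (if t = b then [Sa, Sb, Sc] else [S0]) @ code t ts"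

lemma length_code: "length (code b ts) \<le> 3 * length ts"
  by (induction b ts rule: code.induct) auto

lemma code_append: "code b (ts @ us) = code b ts @ code (last (b # ts)) us"
  by (induction b ts rule: code.induct) auto

text \<open>The blocks \<open>abc\<close> and \<open>0\<close> differ in their first letter, so the
  sign word can be decoded from left to right.\<close>

lemma code_inj:
  assumes "x \<in> cyl m (code b ts)" "x \<in> cyl m (code b us)" "length ts = length us"
  shows "ts = us"
  using assms(3,1,2)
proof (induction ts us arbitrary: m b rule: list_induct2)
  case (Cons t ts u us)
  have "t = u" using Cons.prems by (cases b; cases t; cases u) (auto simp: cyl_Cons)
  with Cons.prems have "x \<in> cyl (m + (if t = b then 3 else 1)) (code t ts)"
    "x \<in> cyl (m + (if t = b then 3 else 1)) (code t us)"
    by (auto simp: cyl_Cons add.commute split: if_splits)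
  with Cons.IH \<open>t = u\<close> show ?case by blast
qed simp

context
  fixes M :: "(int \<Rightarrow> symb) measure"
  assumes markov: "markov_chain_measure stat_prob trans_prob M"
begin

text \<open>After \<open>S0\<close> or \<open>Sc\<close> each block starts with probability 1/2, the
  rest of \<open>abc\<close> is forced, and both blocks end in \<open>S0\<close> or
  \<open>Sc\<close> again. Hence the signs are independent fair coin tosses.\<close>

lemma measure_cyl_code:
  assumes "measure M (cyl m xs) > 0" "xs \<noteq> []" "last xs \<in> {S0, Sc}"
  shows "measure M (cyl m (xs @ code b ts)) = measure M (cyl m xs) * (1/2) ^ length ts"
  using assms
proof (induction ts arbitrary: xs b)
  case (Cons t ts)
  note step = markov_cyl_snoc[OF markov]
  define w where "w = (if t = b then [Sa, Sb, Sc] else [S0])"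
  have w: "measure M (cyl m (xs @ w)) = measure M (cyl m xs) / 2"
  proof (cases "t = b")
    case True
    have 1: "measure M (cyl m (xs @ [Sa])) = measure M (cyl m xs) / 2"
      using step[OF Cons.prems(1,2), of Sa] Cons.prems(3) by (auto simp: trans_prob_def)
    have 2: "measure M (cyl m ((xs @ [Sa]) @ [Sb])) = measure M (cyl m xs) / 2"
      using step[of m "xs @ [Sa]" Sb] Cons.prems(1) 1 by (simp add: trans_prob_def)
    have 3: "measure M (cyl m (((xs @ [Sa]) @ [Sb]) @ [Sc])) = measure M (cyl m xs) / 2"
      using step[of m "(xs @ [Sa]) @ [Sb]" Sc] Cons.prems(1) 2 by (simp add: trans_prob_def)
    then show ?thesis using True by (simp add: w_def)
  next
    case False
    then show ?thesis
      using step[OF Cons.prems(1,2), of S0] Cons.prems(3) by (auto simp: trans_prob_def w_def)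
  qed
  have "measure M (cyl m ((xs @ w) @ code t ts)) = measure M (cyl m (xs @ w)) * (1/2) ^ length ts"
    by (rule Cons.IH) (use w Cons.prems(1) in \<open>auto simp: w_def\<close>)
  then have "measure M (cyl m (xs @ w @ code t ts)) = measure M (cyl m xs) / 2 * (1/2) ^ length ts"
    unfolding w by simp
  then show ?case by (simp add: w_def)
qed simp

lemma measure_cyl_S0_code:
  "measure M (cyl m (S0 # code b ts)) = 1/4 * (1/2) ^ length ts"
  using measure_cyl_code[of m "[S0]" b ts] markov_cyl_single[OF markov, of m S0]
  by (simp add: stat_prob_def)

end

section \<open>Probability of a rise followed by a fall\<close>

definition good_paths :: "nat \<Rightarrow> nat \<Rightarrow> bool list set" where
  "good_paths L n = (\<lambda>(ts, us). ts @ us) ` ({ts. length ts = 2 * n \<and> walk ts \<ge> int L}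
     \<times> {us. length us = 2 * n \<and> walk us \<le> - int L})"

lemma length_good_paths: "ts \<in> good_paths L n \<Longrightarrow> length ts = 4 * n"
  by (auto simp: good_paths_def)

lemma finite_good_paths: "finite (good_paths L n)"
  unfolding good_paths_def by (intro finite_imageI finite_cartesian_product finite_bool_lists)

text \<open>The halves are chosen independently, and each condition holds for at least a quarter of
  the words of length \<open>2 * n\<close>.\<close>

lemma card_good_paths:
  assumes n: "n = 8 * L\<^sup>2"
  shows "16 * card (good_paths L n) \<ge> 16 ^ n"
proof -
  let ?A = "{ts. length ts = 2 * n \<and> walk ts \<ge> int L}"
  let ?B = "{us. length us = 2 * n \<and> walk us \<le> - int L}"
  have "card (good_paths L n) = card (?A \<times> ?B)"
    unfolding good_paths_def by (rule card_image) (auto simp: inj_on_def)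
  also have "\<dots> = card ?A * card ?A"
    by (simp only: card_cartesian_product card_walk_le)
  finally have "16 * card (good_paths L n) = (4 * card ?A) * (4 * card ?A)" by simp
  moreover have "(4 * card ?A) * (4 * card ?A) \<ge> 4 ^ n * 4 ^ n"
    using card_walk_ge[OF n] by (intro mult_mono) auto
  moreover have "(4::nat) ^ n * 4 ^ n = 16 ^ n" by (simp flip: power_mult_distrib)
  ultimately show ?thesis by simp
qed

text \<open>After the leading \<open>S0\<close> either block may follow. Its site will be the one at
  the left end where the test function vanishes.\<close>

definition good_event :: "nat \<Rightarrow> nat \<Rightarrow> int \<Rightarrow> (int \<Rightarrow> symb) set" where
  "good_event L n m = (\<Union>ts\<in>good_paths L n. cyl m (S0 # code True ts))"

lemma good_event_sets:
  assumes "markov_chain_measure stat_prob trans_prob M"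
  shows "good_event L n m \<in> sets M"
  unfolding good_event_def by (intro sets.finite_UN finite_good_paths markov_cyl_sets[OF assms])

text \<open>A factor 1/4 is the stationary weight of the leading \<open>S0\<close>, and 1/16 bounds
  the proportion of good paths among all \<open>2 ^ (4 * n)\<close> sign words. Decodability makes
  the cylinders disjoint.\<close>

lemma measure_good_event:
  assumes M: "markov_chain_measure stat_prob trans_prob M" and n: "n = 8 * L\<^sup>2"
  shows "measure M (good_event L n m) \<ge> 1/64"
proof -
  interpret prob_space M by (rule markov_prob_space[OF M])
  have "disjoint_family_on (\<lambda>ts. cyl m (S0 # code True ts)) (good_paths L n)"
    unfolding disjoint_family_on_def
    using code_inj length_good_paths by (fastforce simp: cyl_Cons)
  then have "measure M (good_event L n m) = (\<Sum>ts\<in>good_paths L n. measure M (cyl m (S0 # code True ts)))"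
    unfolding good_event_def
    by (intro finite_measure_finite_Union finite_good_paths) (use markov_cyl_sets[OF M] in auto)
  also have "\<dots> = (\<Sum>ts\<in>good_paths L n. 1/4 * (1/2) ^ (4 * n))"
    by (intro sum.cong refl) (simp add: measure_cyl_S0_code[OF M] length_good_paths)
  also have "\<dots> = real (16 * card (good_paths L n)) / 16 ^ n / 64"
    by (simp add: power_mult power_divide)
  also have "\<dots> \<ge> 1/64"
  proof -
    have "real (16 * card (good_paths L n)) \<ge> real (16 ^ n)"
      using card_good_paths[OF n] by (rule of_nat_mono)
    then show ?thesis by simp
  qed
  finally show ?thesis .
qed

subsection \<open>Zero-energy solutions\<close>

text \<open>The last sign tells the axis. A block \<open>0\<close> changes the axis and keeps the
  amplitude although the walk moves by one; the summand 0 or 1 in \<open>S\<close> compensates for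
  this. A block \<open>abc\<close> multiplies \<open>u (Suc l)\<close> by \<open>exp 1\<close> and
  \<open>u l\<close> by \<open>exp (- 1)\<close>, in step with the walk.\<close>

lemma code_zero_energy:
  assumes "x \<in> cyl m (code True ts)"
  defines "u \<equiv> sol (\<lambda>i. upsilon (x (m + int i))) 0"
    and "l \<equiv> length (code True ts)"
    and "S \<equiv> real_of_int (walk ts + (if last (True # ts) then 0 else 1))"
  shows "if last (True # ts) then u l = 0 \<and> \<bar>u (Suc l)\<bar> = exp S else u (Suc l) = 0 \<and> \<bar>u l\<bar> = exp S"
  using assms(1) unfolding l_def S_def
proof (induction ts rule: rev_induct)
  case Nil
  show ?case by (simp add: u_def)
next
  case (snoc t ts)
  define b where "b = last (True # ts)"
  define l where "l = length (code True ts)"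
  have x: "x \<in> cyl m (code True ts)" "x \<in> cyl (m + int l) (if t = b then [Sa, Sb, Sc] else [S0])"
    using snoc.prems by (auto simp: code_append cyl_append l_def b_def)
  note IH = snoc.IH[OF x(1), folded l_def b_def]
  have step: "u (Suc (Suc i)) = upsilon (x (m + int i)) * u (Suc i) - u i" for i
    by (simp add: u_def)
  have len: "length (code True (ts @ [t])) = l + (if t = b then 3 else 1)"
    by (simp add: code_append l_def b_def)
  have ee: "exp (- 1 :: real) * exp 1 = 1" by (simp flip: exp_add)
  show ?case
  proof (cases "t = b")
    case True
    then have "x (m + int l) = Sa" "x (m + int (Suc l)) = Sb" "x (m + int (Suc (Suc l))) = Sc"
      using x(2) by (simp_all add: cyl_Cons algebra_simps)
    then have 1: "u (Suc (Suc l)) = - exp 1 * u (Suc l) - u l"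
      and 2: "u (Suc (Suc (Suc l))) = - exp (- 1) * u (Suc (Suc l)) - u (Suc l)"
      and 3: "u (Suc (Suc (Suc (Suc l)))) = - exp 1 * u (Suc (Suc (Suc l))) - u (Suc (Suc l))"
      using step[of l] step[of "Suc l"] step[of "Suc (Suc l)"] by (simp_all add: upsilon_def)
    have len': "length (code True (ts @ [t])) = Suc (Suc (Suc l))" using len True by simp
    have 4: "u (Suc (Suc (Suc l))) = exp (- 1) * u l"
      unfolding 2 1 using ee by (simp add: algebra_simps)
    have 5: "u (Suc (Suc (Suc (Suc l)))) = exp 1 * u (Suc l)"
      unfolding 3 4 1 using ee by (simp add: algebra_simps)
    show ?thesis
    proof (cases b)
      case bT: True
      then show ?thesis using IH True unfolding len' 4 5
        by (simp add: sgb_def abs_mult exp_add)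
    next
      case bF: False
      then show ?thesis using IH True unfolding len' 4 5
        by (simp add: sgb_def abs_mult exp_add exp_diff exp_minus field_simps)
    qed
  next
    case False
    then have "x (m + int l) = S0" using x(2) by (simp add: cyl_Cons)
    then have 1: "u (Suc (Suc l)) = - u l" using step[of l] by (simp add: upsilon_def)
    have len': "length (code True (ts @ [t])) = Suc l" using len False by simp
    show ?thesis
      using IH False unfolding len' 1 by (cases b; cases t) (simp_all add: sgb_def)
  qed
qed

text \<open>The cut solution fails the equation at most at the sites 0, \<open>l\<close> and
  \<open>Suc l\<close>. The shift in \<open>w (Suc i)\<close> puts the zero \<open>u 0\<close> on
  the first site of the block.\<close>

lemma truncated_solution_residual:
  fixes w :: "nat \<Rightarrow> real"
  assumes "l > 0"
  defines "u \<equiv> sol (\<lambda>i. w (Suc i)) 0"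
  defines "g \<equiv> \<lambda>j. if j \<le> l then u j else 0"
  shows "(\<Sum>j<n. (w j * g j - g (Suc j) - g (j - 1))\<^sup>2) \<le> 1 + (u l)\<^sup>2 + (u (Suc l))\<^sup>2"
proof -
  have "(w j * g j - g (Suc j) - g (j - 1))\<^sup>2
      = (if j = 0 then 1 else 0) + (if j = Suc l then (u l)\<^sup>2 else 0) + (if j = l then (u (Suc l))\<^sup>2 else 0)"
    for j
  proof (cases j)
    case 0
    then show ?thesis using assms(1) by (simp add: g_def u_def)
  next
    case (Suc i)
    have step: "u (Suc (Suc i)) = w (Suc i) * u (Suc i) - u i" by (simp add: u_def)
    consider "j < l" | "j = l" | "j = Suc l" | "j > Suc l" by linarith
    then show ?thesis by cases (use Suc step in \<open>auto simp: g_def\<close>)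
  qed
  then have "(\<Sum>j<n. (w j * g j - g (Suc j) - g (j - 1))\<^sup>2)
      = (\<Sum>j<n. if j = 0 then 1 else 0) + (\<Sum>j<n. if j = Suc l then (u l)\<^sup>2 else 0)
        + (\<Sum>j<n. if j = l then (u (Suc l))\<^sup>2 else 0)"
    by (simp only: sum.distrib)
  also have "\<dots> \<le> 1 + (u l)\<^sup>2 + (u (Suc l))\<^sup>2"
    by (intro add_mono) (simp_all add: sum.delta)
  finally show ?thesis .
qed

text \<open>The solution starts with amplitude 1, reaches \<open>exp S1\<close> at \<open>k\<close>
  and has fallen to \<open>exp S\<close> at \<open>l\<close>, so both cuts are made far below the
  peak. The block length allows \<open>3 * (4 * n)\<close> sites for the code, one for the leading
  \<open>S0\<close> and one empty site at the end.\<close>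

lemma good_event_test_function:
  assumes x: "x \<in> good_event L n m" and "n > 0"
  shows "\<exists>g. g 0 = 0 \<and> (\<forall>j. 12 * n + 2 \<le> Suc j \<longrightarrow> g j = 0) \<and>
    (\<Sum>j<12 * n + 2. (upsilon (x (m + int j)) * g j - g (Suc j) - g (j - 1))\<^sup>2)
      < (exp (2 - real L))\<^sup>2 * (\<Sum>j<12 * n + 2. (g j)\<^sup>2)"
proof -
  obtain ts us where ts: "length ts = 2 * n" "walk ts \<ge> int L" "length us = 2 * n" "walk us \<le> - int L"
    and cyl: "x \<in> cyl m (S0 # code True (ts @ us))"
    using x unfolding good_event_def good_paths_def by auto
  have c: "x \<in> cyl (m + 1) (code True (ts @ us))" using cyl by (simp add: cyl_Cons)
  then have c1: "x \<in> cyl (m + 1) (code True ts)" by (simp add: code_append cyl_append)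
  define w where "w j = upsilon (x (m + int j))" for j :: nat
  define u where "u = sol (\<lambda>i. w (Suc i)) 0"
  have u: "u = sol (\<lambda>i. upsilon (x (m + 1 + int i))) 0" by (simp add: u_def w_def algebra_simps)
  define l where "l = length (code True (ts @ us))"
  define k where "k = length (code True ts)"
  define S where "S = real_of_int (walk (ts @ us) + (if last (True # (ts @ us)) then 0 else 1))"
  define S1 where "S1 = real_of_int (walk ts + (if last (True # ts) then 0 else 1))"
  \<comment> \<open>A nonempty second half ensures that both peak sites \<open>k\<close> and
    \<open>Suc k\<close> survive the cut at \<open>l\<close>.\<close>
  have "us \<noteq> []" using ts \<open>n > 0\<close> by auto
  then have "code b us \<noteq> []" for b by (cases us) auto
  then have "k < l" by (simp add: k_def l_def code_append)
  have "l \<le> 3 * (4 * n)" unfolding l_def using length_code[of True "ts @ us"] ts by simp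
  define g where "g j = (if j \<le> l then u j else 0)" for j
  have sq: "a\<^sup>2 = (exp z)\<^sup>2" if "\<bar>a\<bar> = exp z" for a z :: real
    using that by (metis power2_abs)
  have end_amp: "(u l)\<^sup>2 + (u (Suc l))\<^sup>2 = (exp S)\<^sup>2"
    using code_zero_energy[OF c, folded u l_def S_def]
    by (auto dest!: sq split: if_splits)
  have mid_amp: "(u k)\<^sup>2 + (u (Suc k))\<^sup>2 = (exp S1)\<^sup>2"
    using code_zero_energy[OF c1, folded u k_def S1_def]
    by (auto dest!: sq split: if_splits)
  have "real_of_int (walk ts) \<ge> real L" "real_of_int (walk us) \<le> - real L"
    using ts(2,4) by linarith+
  then have S1: "S1 \<ge> real L" and S: "S \<le> 1 + (S1 - real L)"
    unfolding S1_def S_def by auto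
  \<comment> \<open>Common scale of the two errors: the left cut costs 1, at most \<open>y\<close>,
    and the right one at most \<open>exp 2 * y\<close>. The 2 in \<open>exp (2 - L)\<close> comes
    from \<open>1 + exp 2 < exp 4\<close>.\<close>
  define y where "y = exp (2 * (S1 - real L))"
  have y: "y \<ge> 1" using S1 by (simp add: y_def)
  have "(\<Sum>j<12 * n + 2. (w j * g j - g (Suc j) - g (j - 1))\<^sup>2) \<le> 1 + (u l)\<^sup>2 + (u (Suc l))\<^sup>2"
    using truncated_solution_residual[of l w "12 * n + 2"] \<open>k < l\<close> unfolding g_def u_def by simp
  also have "\<dots> = 1 + exp (2 * S)" using end_amp by (simp add: exp_double)
  also have "\<dots> \<le> y + exp 2 * y"
  proof -
    have "exp (2 * S) \<le> exp (2 + 2 * (S1 - real L))" using S by simp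
    also have "\<dots> = exp 2 * y" by (simp only: y_def exp_add)
    finally show ?thesis using y by linarith
  qed
  also have "\<dots> < exp 2 * exp 2 * y"
  proof -
    have e3: "3 \<le> exp (2::real)" using exp_ge_add_one_self[of "2::real"] by simp
    have "3 * exp 2 \<le> exp (2::real) * exp 2" by (rule mult_right_mono[OF e3]) simp
    with e3 have "1 + exp 2 < exp (2::real) * exp 2" by linarith
    then show ?thesis using y mult_strict_right_mono[of "1 + exp 2" "exp 2 * exp 2" y]
      by (simp add: algebra_simps)
  qed
  also have "\<dots> = (exp (2 - real L))\<^sup>2 * (exp S1)\<^sup>2"
    by (simp add: y_def power2_eq_square flip: exp_add)
  also have "\<dots> \<le> (exp (2 - real L))\<^sup>2 * (\<Sum>j<12 * n + 2. (g j)\<^sup>2)"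
  proof (intro mult_left_mono)
    have "(exp S1)\<^sup>2 = (\<Sum>j\<in>{k, Suc k}. (g j)\<^sup>2)"
      using mid_amp \<open>k < l\<close> by (simp add: g_def)
    also have "\<dots> \<le> (\<Sum>j<12 * n + 2. (g j)\<^sup>2)"
      using \<open>k < l\<close> \<open>l \<le> 3 * (4 * n)\<close> by (intro sum_mono2) auto
    finally show "(exp S1)\<^sup>2 \<le> (\<Sum>j<12 * n + 2. (g j)\<^sup>2)" .
  qed simp
  finally have "(\<Sum>j<12 * n + 2. (w j * g j - g (Suc j) - g (j - 1))\<^sup>2)
      < (exp (2 - real L))\<^sup>2 * (\<Sum>j<12 * n + 2. (g j)\<^sup>2)" .
  moreover have "g 0 = 0" by (simp add: g_def u_def)
  moreover have "g j = 0" if "12 * n + 2 \<le> Suc j" for j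
    using that \<open>l \<le> 3 * (4 * n)\<close> by (simp add: g_def)
  ultimately show ?thesis unfolding w_def by blast
qed

section \<open>Dirichlet eigenvalues and the eigenvalue count\<close>

lemma sol_root_in_spectrum:
  assumes root: "sol (\<lambda>i. \<upsilon> (x (int i))) E (Suc (Suc n)) = 0"
  shows "complex_of_real E \<in> spectrum (schroedinger_trunc \<upsilon> x n)"
proof -
  define s where "s = sol (\<lambda>i. \<upsilon> (x (int i))) E"
  define u where "u = vec (n + 1) (\<lambda>i. complex_of_real (s (Suc i)))"
  have u: "u \<in> carrier_vec (n + 1)" by (simp add: u_def)
  have s0: "s 0 = 0" "s (Suc (Suc n)) = 0" using root by (simp_all add: s_def del: sol.simps(3))
  have step: "s (Suc (Suc i)) = (\<upsilon> (x (int i)) - E) * s (Suc i) - s i" for i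
    by (simp add: s_def)
  \<comment> \<open>The case \<open>i = Suc n\<close> is included: there the extension by zero
    agrees with the root condition.\<close>
  have emb: "coord_emb n u (int i) = of_real (s (Suc i))" if "i \<le> Suc n" for i
    using that s0 le_Suc_eq[of i n] by (auto simp: coord_emb_def u_def)
  have "schroedinger_trunc \<upsilon> x n *\<^sub>v u = complex_of_real E \<cdot>\<^sub>v u"
    unfolding schroedinger_trunc_apply[OF u]
  proof (rule eq_vecI)
    fix i assume "i < dim_vec (complex_of_real E \<cdot>\<^sub>v u)"
    then have i: "i \<le> n" by (simp add: u_def)
    have next': "coord_emb n u (int i + 1) = of_real (s (Suc (Suc i)))"
      using emb[of "Suc i"] i by (simp add: add.commute)
    have prev: "coord_emb n u (int i - 1) = of_real (s i)"
    proof (cases i)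
      case 0
      then show ?thesis using s0 by (simp add: coord_emb_def)
    next
      case (Suc j)
      then show ?thesis using emb[of j] i by simp
    qed
    have "schroedinger \<upsilon> x (coord_emb n u) (int i)
        = complex_of_real (- (s (Suc (Suc i)) + s i) + \<upsilon> (x (int i)) * s (Suc i))"
      unfolding schroedinger_def next' prev using emb[of i] i by simp
    also have "- (s (Suc (Suc i)) + s i) + \<upsilon> (x (int i)) * s (Suc i) = E * s (Suc i)"
      unfolding step by (simp add: algebra_simps)
    finally show "coord_proj n (schroedinger \<upsilon> x (coord_emb n u)) $ i = (complex_of_real E \<cdot>\<^sub>v u) $ i"
      using i by (simp add: coord_proj_def u_def)
  qed (simp_all add: coord_proj_def u_def)
  moreover have "u \<noteq> 0\<^sub>v (n + 1)"
  proof
    assume "u = 0\<^sub>v (n + 1)"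
    then have "u $ 0 = 0" by simp
    then show False by (simp add: u_def s_def)
  qed
  moreover have "dim_row (schroedinger_trunc \<upsilon> x n) = n + 1" by (simp add: schroedinger_trunc_def)
  ultimately show ?thesis using u by (auto simp: spectrum_def eigenvalue_def eigenvector_def)
qed

lemma eigenvalue_count_diff_ge:
  assumes "\<epsilon> > 0"
  shows "eigenvalue_count \<upsilon> x n (- \<epsilon>) + card {E. sol (\<lambda>i. \<upsilon> (x (int i))) E (Suc (Suc n)) = 0 \<and> \<bar>E\<bar> < \<epsilon>}
    \<le> eigenvalue_count \<upsilon> x n \<epsilon>"
proof -
  let ?S = "spectrum (schroedinger_trunc \<upsilon> x n)"
  let ?R = "{E. sol (\<lambda>i. \<upsilon> (x (int i))) E (Suc (Suc n)) = 0 \<and> \<bar>E\<bar> < \<epsilon>}"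
  let ?I = "\<lambda>E. complex_of_real ` {..E} \<inter> ?S"
  have "schroedinger_trunc \<upsilon> x n \<in> carrier_mat (n + 1) (n + 1)" by (simp add: schroedinger_trunc_def)
  then have fin: "finite ?S" by (rule card_finite_spectrum)
  have sub: "complex_of_real ` ?R \<subseteq> ?I \<epsilon> - ?I (- \<epsilon>)"
    using sol_root_in_spectrum[of \<upsilon> x _ n] by (auto simp del: sol.simps)
  then have "finite (complex_of_real ` ?R)" using fin by (auto intro: finite_subset)
  have "card (?I (- \<epsilon>)) + card ?R = card (?I (- \<epsilon>)) + card (complex_of_real ` ?R)"
    by (simp add: card_image inj_on_def)
  also have "\<dots> = card (?I (- \<epsilon>) \<union> complex_of_real ` ?R)"
    using sub fin \<open>finite (complex_of_real ` ?R)\<close> by (intro card_Un_disjoint[symmetric]) auto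
  also have "\<dots> \<le> card (?I \<epsilon>)"
    using sub fin assms by (intro card_mono) auto
  finally show ?thesis by (simp add: eigenvalue_count_def)
qed

subsection \<open>The integrated density of states near 0\<close>

text \<open>The truncation has \<open>Suc r\<close> sites, hence room for \<open>Suc r div B\<close>
  disjoint blocks.\<close>

lemma card_good_blocks_le:
  fixes x :: "int \<Rightarrow> symb" and L :: nat
  assumes "n > 0" and B: "B = 12 * n + 2"
  defines "\<epsilon> \<equiv> exp (2 - real L)"
  shows "card {k \<in> {..<Suc r div B}. x \<in> good_event L n (int (k * B))}
    \<le> card {E. sol (\<lambda>i. upsilon (x (int i))) E (Suc (Suc r)) = 0 \<and> \<bar>E\<bar> < \<epsilon>}"
proof -
  let ?G = "{k \<in> {..<Suc r div B}. x \<in> good_event L n (int (k * B))}"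
  have "\<forall>k\<in>?G. \<exists>g. g 0 = 0 \<and> (\<forall>j. B \<le> Suc j \<longrightarrow> g j = 0) \<and>
    (\<Sum>j<B. (upsilon (x (int (k * B + j))) * g j - g (Suc j) - g (j - 1))\<^sup>2) < \<epsilon>\<^sup>2 * (\<Sum>j<B. (g j)\<^sup>2)"
    using good_event_test_function[OF _ \<open>n > 0\<close>] unfolding B \<epsilon>_def of_nat_add by blast
  then obtain g where g: "\<forall>k\<in>?G. g k 0 = 0 \<and> (\<forall>j. B \<le> Suc j \<longrightarrow> g k j = 0) \<and>
    (\<Sum>j<B. (upsilon (x (int (k * B + j))) * g k j - g k (Suc j) - g k (j - 1))\<^sup>2)
      < \<epsilon>\<^sup>2 * (\<Sum>j<B. (g k j)\<^sup>2)"
    by (rule bchoice[THEN exE])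
  show ?thesis
    by (rule card_small_eigenvalues_ge[where K = "Suc r div B" and B = B and g = g])
      (use g in \<open>auto simp: \<epsilon>_def simp del: sol.simps\<close>)
qed

text \<open>Linearity of expectation bounds the mean density of good blocks from below, however they
  depend on each other. The reverse Fatou lemma carries the bound to the almost sure limit, the
  constant \<open>N \<epsilon> - N (- \<epsilon>)\<close>.\<close>

lemma ids_diff_ge:
  assumes M: "markov_chain_measure stat_prob trans_prob M"
    and N: "integrated_density_of_states M upsilon N"
    and "L > 0"
  defines "\<epsilon> \<equiv> exp (2 - real L)"
  shows "1 / (64 * (96 * (real L)\<^sup>2 + 2)) \<le> N \<epsilon> - N (- \<epsilon>)"
proof -
  interpret prob_space M by (rule markov_prob_space[OF M])
  define n where "n = 8 * L\<^sup>2"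
  define B where "B = 12 * n + 2"
  have "n > 0" using \<open>L > 0\<close> by (simp add: n_def)
  have "B > 0" by (simp add: B_def)
  have "\<epsilon> > 0" by (simp add: \<epsilon>_def)
  let ?A = "\<lambda>k. good_event L n (int (k * B))"
  define u where "u r x = (\<Sum>k<Suc r div B. indicator (?A k) x) / real (r + 1)" for r and x :: "int \<Rightarrow> symb"
  define d where "d r x = real (eigenvalue_count upsilon x r \<epsilon>) / real (r + 1)
      - real (eigenvalue_count upsilon x r (- \<epsilon>)) / real (r + 1)" for r x
  have u_le_d: "u r x \<le> d r x" for r x
  proof -
    have "(\<Sum>k<Suc r div B. indicator (?A k) x) = real (card {k \<in> {..<Suc r div B}. x \<in> ?A k})"
      by (simp add: indicator_def sum.If_cases Int_def)
    moreover have "eigenvalue_count upsilon x r (- \<epsilon>) + card {k \<in> {..<Suc r div B}. x \<in> ?A k}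
        \<le> eigenvalue_count upsilon x r \<epsilon>"
      using card_good_blocks_le[OF \<open>n > 0\<close> B_def, of r x L] eigenvalue_count_diff_ge[OF \<open>\<epsilon> > 0\<close>, of upsilon x r]
      unfolding \<epsilon>_def by linarith
    ultimately show ?thesis
      unfolding u_def d_def by (simp add: divide_right_mono flip: diff_divide_distrib)
  qed
  have A_sets: "?A k \<in> sets M" for k by (rule good_event_sets[OF M])
  have u_nonneg: "u r x \<ge> 0" for r x by (simp add: u_def sum_nonneg)
  have u_meas: "u r \<in> borel_measurable M" for r
    unfolding u_def using A_sets by measurable
  have u_le_1: "u r x \<le> 1" for r x
  proof -
    have "(\<Sum>k<Suc r div B. indicator (?A k) x) \<le> (\<Sum>k<Suc r div B. 1 :: real)"
      by (intro sum_mono) (simp add: indicator_def)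
    also have "\<dots> = real (Suc r div B)" by simp
    also have "\<dots> \<le> real (Suc r)" by (simp only: of_nat_le_iff div_le_dividend)
    finally show ?thesis by (simp add: u_def divide_le_eq)
  qed
  \<comment> \<open>Rounding down to whole blocks loses at most one block, which accounts for the
    subtracted term.\<close>
  have int_u: "ennreal (1 / (64 * real B) - 1 / (64 * real (r + 1))) \<le> (\<integral>\<^sup>+ x. ennreal (u r x) \<partial>M)" for r
  proof -
    define X where "X = real (r + 1)"
    have X: "X > 0" by (simp add: X_def)
    have "real_of_int \<lfloor>X / real B\<rfloor> = real (Suc r div B)"
      using floor_divide_of_nat_eq[of "r + 1" B, where 'a = real] by (simp add: X_def)
    then have floor: "X / real B - 1 \<le> real (Suc r div B)"
      using real_of_int_floor_gt_diff_one[of "X / real B"] by linarith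
    have "1 / (64 * real B) - 1 / (64 * X) = (X / real B - 1) * (1 / 64) / X"
      using X \<open>B > 0\<close> by (simp add: field_simps)
    also have "\<dots> \<le> real (Suc r div B) * (1 / 64) / X"
      using floor X by (intro divide_right_mono mult_right_mono) auto
    finally have "1 / (64 * real B) - 1 / (64 * real (r + 1)) \<le> real (Suc r div B) * (1 / 64) / real (r + 1)"
      unfolding X_def .
    also have "\<dots> \<le> (\<Sum>k<Suc r div B. measure M (?A k)) / real (r + 1)"
      using sum_mono[of "{..<Suc r div B}" "\<lambda>_. 1/64" "\<lambda>k. measure M (?A k)"]
        measure_good_event[OF M n_def] by (intro divide_right_mono) auto
    also have "\<dots> = (\<integral>x. u r x \<partial>M)"
    proof -
      have "integrable M (indicator (?A k) :: _ \<Rightarrow> real)" for k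
        using A_sets by (simp add: integrable_real_indicator less_top[symmetric])
      then have "(\<integral>x. (\<Sum>k<Suc r div B. indicator (?A k) x) \<partial>M) = (\<Sum>k<Suc r div B. measure M (?A k))"
        using markov_space[OF M] by (subst Bochner_Integration.integral_sum) auto
      then show ?thesis by (simp add: u_def)
    qed
    finally have "ennreal (1 / (64 * real B) - 1 / (64 * real (r + 1))) \<le> ennreal (\<integral>x. u r x \<partial>M)"
      by (rule ennreal_leI)
    moreover have "integrable M (u r)"
      using u_meas u_nonneg u_le_1 by (intro integrable_const_bound[of _ 1]) auto
    ultimately show ?thesis
      using u_nonneg by (simp add: nn_integral_eq_integral)
  qed
  have "ennreal (1 / (64 * real B)) = limsup (\<lambda>r. ennreal (1 / (64 * real B) - 1 / (64 * real (r + 1))))"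
  proof (rule lim_imp_Limsup[symmetric])
    have "(\<lambda>r. 1 / (64 * real B) - 1 / (64 * real (r + 1))) \<longlonglongrightarrow> 1 / (64 * real B)" by real_asymp
    then show "(\<lambda>r. ennreal (1 / (64 * real B) - 1 / (64 * real (r + 1)))) \<longlonglongrightarrow> ennreal (1 / (64 * real B))"
      by (rule tendsto_ennrealI)
  qed simp
  also have "\<dots> \<le> limsup (\<lambda>r. \<integral>\<^sup>+ x. ennreal (u r x) \<partial>M)"
    using int_u by (intro Limsup_mono always_eventually) auto
  \<comment> \<open>Reverse Fatou, with the constant 1 as dominating function.\<close>
  also have "\<dots> \<le> (\<integral>\<^sup>+ x. limsup (\<lambda>r. ennreal (u r x)) \<partial>M)"
    using u_meas u_le_1 by (intro nn_integral_limsup[where w = "\<lambda>_. 1"]) (auto simp: emeasure_space_1)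
  also have "\<dots> \<le> (\<integral>\<^sup>+ x. ennreal (N \<epsilon> - N (- \<epsilon>)) \<partial>M)"
  proof (rule nn_integral_mono_AE)
    have "AE x in M. (\<lambda>r. d r x) \<longlonglongrightarrow> N \<epsilon> - N (- \<epsilon>)"
      using N[unfolded integrated_density_of_states_def, THEN spec, of \<epsilon>]
        N[unfolded integrated_density_of_states_def, THEN spec, of "- \<epsilon>"]
      by eventually_elim (auto simp: d_def intro: tendsto_diff)
    then show "AE x in M. limsup (\<lambda>r. ennreal (u r x)) \<le> ennreal (N \<epsilon> - N (- \<epsilon>))"
    proof eventually_elim
      case (elim x)
      have "limsup (\<lambda>r. ennreal (u r x)) \<le> limsup (\<lambda>r. ennreal (d r x))"
        using u_le_d by (intro Limsup_mono always_eventually) (auto intro: ennreal_leI)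
      also have "\<dots> = ennreal (N \<epsilon> - N (- \<epsilon>))"
        using elim by (intro lim_imp_Limsup tendsto_ennrealI) auto
      finally show ?case .
    qed
  qed
  also have "\<dots> = ennreal (N \<epsilon> - N (- \<epsilon>))" by (simp add: emeasure_space_1)
  \<comment> \<open>\<open>ennreal\<close> sends negative reals to 0; the real inequality follows
    because the left-hand side is positive.\<close>
  finally have "1 / (64 * real B) \<le> N \<epsilon> - N (- \<epsilon>)"
    using \<open>B > 0\<close> by (auto simp: ennreal_le_iff2 divide_le_0_iff)
  moreover have "real B = 96 * (real L)\<^sup>2 + 2" by (simp add: B_def n_def)
  ultimately show ?thesis by simp
qed

theorem theorem1:
  fixes M :: "(int \<Rightarrow> symb) measure" and N :: "real \<Rightarrow> real" and \<beta> :: real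
  assumes "markov_chain_measure stat_prob trans_prob M"
    and "integrated_density_of_states M upsilon N"
    and "\<beta> > 2"
  shows "\<not> log_hoelder_at 1 \<beta> N 0"
proof
  assume "log_hoelder_at 1 \<beta> N 0"
  then obtain C where C: "\<forall>\<^sub>F E in at 0. \<bar>N E - N 0\<bar> \<le> C * exp (- \<beta> * (ln (ln (1 / dist E 0))) powr 1)"
    unfolding log_hoelder_at_def by blast
  have "filterlim (\<lambda>L. exp (2 - real L)) (at 0) sequentially"
    "filterlim (\<lambda>L. - exp (2 - real L)) (at 0) sequentially" by real_asymp+
  note lims = this[THEN eventually_compose_filterlim[OF C]]
  \<comment> \<open>Here \<beta> > 2 enters: the power outgrows the quadratic block length.\<close>
  have "filterlim (\<lambda>L. (real L - 2) powr \<beta> / (64 * (96 * (real L)\<^sup>2 + 2))) at_top sequentially"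
    using \<open>\<beta> > 2\<close> by real_asymp
  then have "\<forall>\<^sub>F L in sequentially. 2 * C < (real L - 2) powr \<beta> / (64 * (96 * (real L)\<^sup>2 + 2))"
    by (simp add: filterlim_at_top_dense)
  \<comment> \<open>For \<open>L > 3\<close> the number \<open>ln (L - 2)\<close> is positive, so
    that \<open>powr 1\<close> leaves it unchanged.\<close>
  with lims eventually_gt_at_top[of 3] have "\<forall>\<^sub>F L::nat in sequentially. False"
  proof eventually_elim
    case (elim L)
    let ?\<epsilon> = "exp (2 - real L)"
    have "1 / ?\<epsilon> = exp (real L - 2)" by (simp add: exp_diff)
    then have "exp (- \<beta> * (ln (ln (1 / ?\<epsilon>))) powr 1) = (real L - 2) powr (- \<beta>)"
      using elim(3) by (simp add: powr_def)
    \<comment> \<open>Triangle inequality through \<open>N 0\<close>, using the modulus at both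
      energies.\<close>
    then have "N ?\<epsilon> - N (- ?\<epsilon>) \<le> 2 * C * (real L - 2) powr (- \<beta>)"
      using elim(1,2) by simp
    moreover have "1 / (64 * (96 * (real L)\<^sup>2 + 2)) \<le> N ?\<epsilon> - N (- ?\<epsilon>)"
      using ids_diff_ge[OF assms(1,2)] elim(3) by simp
    ultimately have "1 / (64 * (96 * (real L)\<^sup>2 + 2)) * (real L - 2) powr \<beta>
        \<le> 2 * C * (real L - 2) powr (- \<beta>) * (real L - 2) powr \<beta>"
      by (intro mult_right_mono) auto
    also have "\<dots> = 2 * C" using elim(3) by (simp add: powr_minus)
    finally show False using elim(4) by simp
  qed
  then show False by simp
qed

end
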